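(* Let $(M,\mathcal D,\langle\cdot,\cdot\rangle)$ be an equiregular sub-Riemannian manifold with Popp's volume $\mathcal P\in\Omega^n(M)$, and let $\mathrm{Iso}(M)$ be the group of isometries of the sub-Riemannian manifold $M$. If $\mathrm{Iso}(M)$ acts transitively on $M$, then Popp's volume is the unique volume form $\mu$ on $M$ (up to multiplication by a scalar constant) such that sub-Riemannian (local) isometries are volume preserving transformations for $\mu$, i.e. such that $\phi^*\mu=\mu$ for every sub-Riemannian (local) isometry $\phi$ of $M$.
   Context: Sub-Riemannian manifold: a triple $(M,\mathcal D,\langle\cdot,\cdot\rangle)$ where $M$ is a connected orientable smooth manifold of dimension $n\ge 3$, $\mathcal D\subset TM$ is a smooth distribution of constant rank $k<n$, and $\langle\cdot,\cdot\rangle_q$ is an inner product on $\mathcal D_q$ depending smoothly on $q$. $\mathcal D$ is assumed bracket-generating: iterated Lie brackets of smooth sections of $\mathcal D$ span $T_qM$ at every $q$. Flag: $\mathcal D^0_q=\{0\}$, $\mathcal D^1=\mathcal D$, $\mathcal D^{i+1}_q=\mathcal D^i_q+[\mathcal D^i,\mathcal D]_q$. $\mathcal D$ is equiregular if $k_i:=\dim\mathcal D^i_q$ does not depend on $q$ for every $i$ (with $k_0=0$, $k_1=k$); the step is the minimal $m$ with $\mathcal D^m=TM$. Then each $\mathcal D^i$ is a distribution. Popp's volume: for $q\in M$ and $1\le i\le m$, the linear map $$\pi_i:\otimes^i\mathcal D_q\to\mathcal D^i_q/\mathcal D^{i-1}_q,\qquad \pi_i(v_1\otimes\cdots\otimes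 v_i)=[V_1,[V_2,\dots,[V_{i-1},V_i]]]_q \bmod \mathcal D^{i-1}_q,$$ where $V_j$ is any local section of $\mathcal D$ with $V_j(q)=v_j$, is well defined and surjective ($\pi_1$ is the identity). Give $\otimes^i\mathcal D_q$ the inner product induced by that of $\mathcal D_q$, and $\mathcal D^i_q/\mathcal D^{i-1}_q$ the inner product whose norm is $\|Y\|=\min\{\|Z\| : \pi_i(Z)=Y\}$. Let $\mathrm{gr}_q(\mathcal D)=\bigoplus_{i=1}^m\mathcal D^i_q/\mathcal D^{i-1}_q$ be the orthogonal direct sum, and let $\mu_q\in\wedge^n\mathrm{gr}_q(\mathcal D)^*$ be the wedge of the elements of an orthonormal dual basis (defined up to sign). Let $\theta_q:\wedge^nT_qM\to\wedge^n\mathrm{gr}_q(\mathcal D)$ be the canonical isomorphism sending $v_1\wedge\cdots\wedge v_n$ to $\widehat\theta(v_1)\wedge\cdots\wedge\widehat\theta(v_n)$, where $v_1,\dots,v_n$ is any basis of $T_qM$ such that $v_1,\dots,v_{k_i}$ is a basis of $\mathcal D^i_q$ for all $i$, and $\widehat\theta(v_l)$ is the class of $v_l$ in $\mathcal D^{i}_q/\mathcal D^{i-1}_q$ for $k_{i-1}<l\le k_{i}$ ($\theta_q$ does not depend on the basis). Popp's volume is the smooth $n$-form $\mathcal P\in\Omega^n(M)$ with $\mathcal P_q=\mu_q\circ\theta_q$, these local $n$-forms being glued together using the orientability of $M$. Isometry: a (local) diffeomorphism $\phi:M\to M$ is a (local) isometry if $\phi_*(\mathcal D_q)=\mathcal D_{\phi(q)}$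 for all $q\in M$ and $\langle\phi_*X,\phi_*Y\rangle_{\phi(q)}=\langle X,Y\rangle_q$ for all $q\in M$ and $X,Y\in\mathcal D_q$. Volume preserving transformation: for a volume form $\mu\in\Omega^n(M)$ (a nowhere vanishing smooth $n$-form), a (local) diffeomorphism $\phi:M\to M$ is a (local) volume preserving transformation for $\mu$ if $\phi^*\mu=\mu$.
   Formalization: Invariance φ*μ = μ is required only for orientation-preserving (local) isometries, since orientation-reversing ones send Popp's volume to its negative (e.g. on R × Heisenberg); for all local isometries, φ*P = ±P pointwise is stated. *)

theory Defs
  imports "HOL-Analysis.Analysis"
begin

section \<open>Smooth manifolds\<close>

text \<open>C^k and smooth maps; the set \<open>S\<close> is always open below.\<close>

primrec Ck_on :: "nat \<Rightarrow> 'e::real_normed_vector set \<Rightarrow> ('e \<Rightarrow> 'f::real_normed_vector) \<Rightarrow> bool" where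
  "Ck_on 0 S f \<longleftrightarrow> continuous_on S f"
| "Ck_on (Suc k) S f \<longleftrightarrow>
     (\<forall>x\<in>S. f differentiable (at x)) \<and> (\<forall>v. Ck_on k S (\<lambda>x. frechet_derivative f (at x) v))"

definition smooth_on :: "'e::real_normed_vector set \<Rightarrow> ('e \<Rightarrow> 'f::real_normed_vector) \<Rightarrow> bool" where
  "smooth_on S f \<longleftrightarrow> (\<forall>k. Ck_on k S f)"

text \<open>The manifold \<open>M\<close> is the whole type \<open>'a\<close>. A chart is a pair of its domain and its
  coordinate map, which is relevant only on the domain. The smooth structure is the one generated
  by the atlas; no maximality is required.\<close>

type_synonym ('a, 'n) chart = "'a set \<times> ('a \<Rightarrow> real^'n)"

definition chart_inv :: "('a, 'n) chart \<Rightarrow> real^'n \<Rightarrow> 'a" where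
  "chart_inv c = inv_into (fst c) (snd c)"

definition is_chart :: "('a::topological_space, 'n::finite) chart \<Rightarrow> bool" where
  "is_chart c \<longleftrightarrow> open (fst c) \<and> open (snd c ` fst c) \<and>
     homeomorphism (fst c) (snd c ` fst c) (snd c) (chart_inv c)"

definition smooth_atlas :: "('a::topological_space, 'n::finite) chart set \<Rightarrow> bool" where
  "smooth_atlas A \<longleftrightarrow> (\<forall>c\<in>A. is_chart c) \<and> (\<Union>c\<in>A. fst c) = UNIV \<and>
     (\<forall>c\<in>A. \<forall>d\<in>A. smooth_on (snd c ` (fst c \<inter> fst d)) (snd d \<circ> chart_inv c))"

definition orientable :: "('a::topological_space, 'n::finite) chart set \<Rightarrow> bool" where
  "orientable A \<longleftrightarrow> (\<exists>A'. smooth_atlas A' \<and> smooth_atlas (A \<union> A') \<and>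
     (\<forall>c\<in>A'. \<forall>d\<in>A'. \<forall>q\<in>fst c \<inter> fst d.
        det (matrix (frechet_derivative (snd d \<circ> chart_inv c) (at (snd c q)))) > 0))"

text \<open>The tangent space at \<open>q\<close> is represented by the model space: a tangent vector at \<open>q\<close> is
  given by its components in the chosen chart \<open>chart_at A q\<close>. Its components in another chart
  \<open>c\<close> are obtained by \<open>change A (chart_at A q) c q\<close>. Hence a vector field is a
  function \<open>'a \<Rightarrow> real^'n\<close>, whose smoothness is tested on its chart representations.\<close>

definition chart_at :: "('a, 'n) chart set \<Rightarrow> 'a \<Rightarrow> ('a, 'n) chart" where
  "chart_at A q = (SOME c. c \<in> A \<and> q \<in> fst c)"

definition change :: "('a, 'n::finite) chart \<Rightarrow> ('a, 'n) chart \<Rightarrow> 'a \<Rightarrow> real^'n \<Rightarrow> real^'n" where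
  "change c d q = frechet_derivative (snd d \<circ> chart_inv c) (at (snd c q))"

definition smooth_fun_on :: "('a::topological_space, 'n::finite) chart set \<Rightarrow> 'a set \<Rightarrow> ('a \<Rightarrow> real) \<Rightarrow> bool" where
  "smooth_fun_on A U f \<longleftrightarrow> (\<forall>c\<in>A. smooth_on (snd c ` (fst c \<inter> U)) (f \<circ> chart_inv c))"

definition field_rep :: "('a, 'n::finite) chart set \<Rightarrow> ('a, 'n) chart \<Rightarrow> ('a \<Rightarrow> real^'n) \<Rightarrow> real^'n \<Rightarrow> real^'n" where
  "field_rep A c X x = (let q = chart_inv c x in change (chart_at A q) c q (X q))"

definition smooth_field_on :: "('a::topological_space, 'n::finite) chart set \<Rightarrow> 'a set \<Rightarrow> ('a \<Rightarrow> real^'n) \<Rightarrow> bool" where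
  "smooth_field_on A U X \<longleftrightarrow> (\<forall>c\<in>A. smooth_on (snd c ` (fst c \<inter> U)) (field_rep A c X))"

text \<open>The coordinate formula \<open>[X,Y] = DY(X) - DX(Y)\<close>, used at \<open>q\<close> in the chart \<open>chart_at A q\<close>.\<close>

definition bracket :: "('a, 'n::finite) chart set \<Rightarrow> ('a \<Rightarrow> real^'n) \<Rightarrow> ('a \<Rightarrow> real^'n) \<Rightarrow> 'a \<Rightarrow> real^'n" where
  "bracket A X Y q = (let c = chart_at A q in
     frechet_derivative (field_rep A c Y) (at (snd c q)) (X q)
   - frechet_derivative (field_rep A c X) (at (snd c q)) (Y q))"

fun nested_bracket :: "('a, 'n::finite) chart set \<Rightarrow> ('a \<Rightarrow> real^'n) list \<Rightarrow> 'a \<Rightarrow> real^'n" where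
  "nested_bracket A [] = (\<lambda>q. 0)"
| "nested_bracket A [X] = X"
| "nested_bracket A (X # Y # Xs) = bracket A X (nested_bracket A (Y # Xs))"


section \<open>Maps and differential forms of top degree\<close>

definition smooth_map_on :: "('a::topological_space, 'n::finite) chart set \<Rightarrow> 'a set \<Rightarrow> ('a \<Rightarrow> 'a) \<Rightarrow> bool" where
  "smooth_map_on A W \<phi> \<longleftrightarrow> continuous_on W \<phi> \<and>
     (\<forall>c\<in>A. \<forall>d\<in>A. smooth_on (snd c ` (fst c \<inter> W \<inter> \<phi> -` fst d)) (snd d \<circ> \<phi> \<circ> chart_inv c))"

text \<open>The differential \<open>\<phi>\<^sub>*\<close> from the tangent space at \<open>q\<close> to the one at \<open>\<phi> q\<close>.\<close>

definition push :: "('a, 'n::finite) chart set \<Rightarrow> ('a \<Rightarrow> 'a) \<Rightarrow> 'a \<Rightarrow> real^'n \<Rightarrow> real^'n" where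
  "push A \<phi> q = (let c = chart_at A q; d = chart_at A (\<phi> q) in
     frechet_derivative (snd d \<circ> \<phi> \<circ> chart_inv c) (at (snd c q)))"

definition diffeo :: "('a::topological_space, 'n::finite) chart set \<Rightarrow> ('a \<Rightarrow> 'a) \<Rightarrow> bool" where
  "diffeo A \<phi> \<longleftrightarrow> bij \<phi> \<and> smooth_map_on A UNIV \<phi> \<and> smooth_map_on A UNIV (inv \<phi>)"

definition local_diffeo_on :: "('a::topological_space, 'n::finite) chart set \<Rightarrow> 'a set \<Rightarrow> ('a \<Rightarrow> 'a) \<Rightarrow> bool" where
  "local_diffeo_on A W \<phi> \<longleftrightarrow> open W \<and>
     (\<forall>q\<in>W. \<exists>V. open V \<and> q \<in> V \<and> V \<subseteq> W \<and> inj_on \<phi> V \<and> open (\<phi> ` V) \<and>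
        smooth_map_on A V \<phi> \<and> smooth_map_on A (\<phi> ` V) (inv_into V \<phi>))"

text \<open>An n-form assigns to each point a function of n tangent vectors, indexed by \<open>'n\<close>.\<close>

type_synonym ('a, 'n) form = "'a \<Rightarrow> ('n \<Rightarrow> real^'n) \<Rightarrow> real"

definition alternating_multilinear :: "(('n::finite \<Rightarrow> real^'n) \<Rightarrow> real) \<Rightarrow> bool" where
  "alternating_multilinear \<omega> \<longleftrightarrow>
     (\<forall>v a. linear (\<lambda>x. \<omega> (v(a := x)))) \<and> (\<forall>v a b. a \<noteq> b \<and> v a = v b \<longrightarrow> \<omega> v = 0)"

definition form_rep :: "('a, 'n::finite) chart set \<Rightarrow> ('a, 'n) chart \<Rightarrow> ('a, 'n) form \<Rightarrow> real^'n \<Rightarrow> ('n \<Rightarrow> real^'n) \<Rightarrow> real" where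
  "form_rep A c \<omega> x v = (let q = chart_inv c x in \<omega> q (\<lambda>a. change c (chart_at A q) q (v a)))"

definition smooth_form :: "('a::topological_space, 'n::finite) chart set \<Rightarrow> ('a, 'n) form \<Rightarrow> bool" where
  "smooth_form A \<omega> \<longleftrightarrow> (\<forall>q. alternating_multilinear (\<omega> q)) \<and>
     (\<forall>c\<in>A. \<forall>v. smooth_on (snd c ` fst c) (\<lambda>x. form_rep A c \<omega> x v))"

definition volume_form :: "('a::topological_space, 'n::finite) chart set \<Rightarrow> ('a, 'n) form \<Rightarrow> bool" where
  "volume_form A \<omega> \<longleftrightarrow> smooth_form A \<omega> \<and> (\<forall>q. \<exists>v. \<omega> q v \<noteq> 0)"

definition pullback :: "('a, 'n::finite) chart set \<Rightarrow> ('a \<Rightarrow> 'a) \<Rightarrow> ('a, 'n) form \<Rightarrow> ('a, 'n) form" where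
  "pullback A \<phi> \<omega> q v = \<omega> (\<phi> q) (\<lambda>a. push A \<phi> q (v a))"

definition volume_preserving_on ::
  "('a, 'n::finite) chart set \<Rightarrow> 'a set \<Rightarrow> ('a, 'n) form \<Rightarrow> ('a \<Rightarrow> 'a) \<Rightarrow> bool" where
  "volume_preserving_on A W \<mu> \<phi> \<longleftrightarrow> (\<forall>q\<in>W. pullback A \<phi> \<mu> q = \<mu> q)"

text \<open>On a connected orientable manifold this does not depend on the choice of \<open>\<nu>\<close>, since two
  volume forms differ by a function of constant sign.\<close>

definition orientation_preserving_on ::
  "('a::topological_space, 'n::finite) chart set \<Rightarrow> 'a set \<Rightarrow> ('a \<Rightarrow> 'a) \<Rightarrow> bool" where
  "orientation_preserving_on A W \<phi> \<longleftrightarrow>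
     (\<forall>\<nu>. volume_form A \<nu> \<longrightarrow> (\<forall>q\<in>W. \<exists>r>0. \<forall>v. pullback A \<phi> \<nu> q v = r * \<nu> q v))"


section \<open>Sub-Riemannian manifolds\<close>

definition inner_product_on :: "'v::real_vector set \<Rightarrow> ('v \<Rightarrow> 'v \<Rightarrow> real) \<Rightarrow> bool" where
  "inner_product_on S B \<longleftrightarrow>
     (\<forall>x\<in>S. \<forall>y\<in>S. B x y = B y x) \<and>
     (\<forall>x\<in>S. \<forall>y\<in>S. \<forall>z\<in>S. B (x + y) z = B x z + B y z) \<and>
     (\<forall>r. \<forall>x\<in>S. \<forall>y\<in>S. B (r *\<^sub>R x) y = r * B x y) \<and>
     (\<forall>x\<in>S. x \<noteq> 0 \<longrightarrow> B x x > 0)"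

definition smooth_distribution ::
  "('a::topological_space, 'n::finite) chart set \<Rightarrow> ('a \<Rightarrow> (real^'n) set) \<Rightarrow> nat \<Rightarrow> bool" where
  "smooth_distribution A D k \<longleftrightarrow>
     (\<forall>q. subspace (D q) \<and> dim (D q) = k) \<and>
     (\<forall>q. \<exists>U X. open U \<and> q \<in> U \<and> (\<forall>i<k. smooth_field_on A U (X i)) \<and>
        (\<forall>p\<in>U. D p = span ((\<lambda>i::nat. X i p) ` {..<k})))"

definition sections ::
  "('a::topological_space, 'n::finite) chart set \<Rightarrow> ('a \<Rightarrow> (real^'n) set) \<Rightarrow> 'a set \<Rightarrow> ('a \<Rightarrow> real^'n) set" where
  "sections A D U = {X. smooth_field_on A U X \<and> (\<forall>p\<in>U. X p \<in> D p)}"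

definition smooth_metric ::
  "('a::topological_space, 'n::finite) chart set \<Rightarrow> ('a \<Rightarrow> (real^'n) set) \<Rightarrow>
   ('a \<Rightarrow> real^'n \<Rightarrow> real^'n \<Rightarrow> real) \<Rightarrow> bool" where
  "smooth_metric A D g \<longleftrightarrow>
     (\<forall>q. inner_product_on (D q) (g q)) \<and>
     (\<forall>U. open U \<longrightarrow> (\<forall>X\<in>sections A D U. \<forall>Y\<in>sections A D U.
        smooth_fun_on A U (\<lambda>q. g q (X q) (Y q))))"

text \<open>Right-nested brackets suffice, because every iterated bracket is a linear combination of
  right-nested ones of the same length (Jacobi identity). Sections defined near the point and
  global sections have the same germs.\<close>

definition bracket_generating ::
  "('a::topological_space, 'n::finite) chart set \<Rightarrow> ('a \<Rightarrow> (real^'n) set) \<Rightarrow> bool" where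
  "bracket_generating A D \<longleftrightarrow> (\<forall>q. span {nested_bracket A Vs q | Vs U.
     open U \<and> q \<in> U \<and> set Vs \<subseteq> sections A D U \<and> Vs \<noteq> []} = UNIV)"

definition sub_riemannian_manifold ::
  "('a::{t2_space, second_countable_topology}, 'n::finite) chart set \<Rightarrow> ('a \<Rightarrow> (real^'n) set) \<Rightarrow>
   ('a \<Rightarrow> real^'n \<Rightarrow> real^'n \<Rightarrow> real) \<Rightarrow> bool" where
  "sub_riemannian_manifold A D g \<longleftrightarrow>
     CARD('n) \<ge> 3 \<and> connected (UNIV :: 'a set) \<and> smooth_atlas A \<and> orientable A \<and>
     (\<exists>k < CARD('n). smooth_distribution A D k) \<and> smooth_metric A D g \<and> bracket_generating A D"

text \<open>The space \<open>D\<^sup>i\<^sub>q\<close>, generated by the brackets of length at most \<open>i\<close> of local sections of \<open>D\<close>;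
  the order of the factors in \<open>D\<^bsup>i+1\<^esup> = D\<^sup>i + [D\<^sup>i, D]\<close> only affects signs.\<close>

definition flag ::
  "('a::topological_space, 'n::finite) chart set \<Rightarrow> ('a \<Rightarrow> (real^'n) set) \<Rightarrow> nat \<Rightarrow> 'a \<Rightarrow> (real^'n) set" where
  "flag A D i q = span {nested_bracket A Vs q | Vs U.
     open U \<and> q \<in> U \<and> set Vs \<subseteq> sections A D U \<and> Vs \<noteq> [] \<and> length Vs \<le> i}"

definition equiregular ::
  "('a::topological_space, 'n::finite) chart set \<Rightarrow> ('a \<Rightarrow> (real^'n) set) \<Rightarrow> bool" where
  "equiregular A D \<longleftrightarrow> (\<forall>i p q. dim (flag A D i p) = dim (flag A D i q))"

definition isometric_on ::
  "('a, 'n::finite) chart set \<Rightarrow> ('a \<Rightarrow> (real^'n) set) \<Rightarrow> ('a \<Rightarrow> real^'n \<Rightarrow> real^'n \<Rightarrow> real) \<Rightarrow>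
   'a set \<Rightarrow> ('a \<Rightarrow> 'a) \<Rightarrow> bool" where
  "isometric_on A D g W \<phi> \<longleftrightarrow> (\<forall>q\<in>W. push A \<phi> q ` D q = D (\<phi> q) \<and>
     (\<forall>X\<in>D q. \<forall>Y\<in>D q. g (\<phi> q) (push A \<phi> q X) (push A \<phi> q Y) = g q X Y))"

definition Iso ::
  "('a::topological_space, 'n::finite) chart set \<Rightarrow> ('a \<Rightarrow> (real^'n) set) \<Rightarrow>
   ('a \<Rightarrow> real^'n \<Rightarrow> real^'n \<Rightarrow> real) \<Rightarrow> ('a \<Rightarrow> 'a) set" where
  "Iso A D g = {\<phi>. diffeo A \<phi> \<and> isometric_on A D g UNIV \<phi>}"

definition local_isometry_on ::
  "('a::topological_space, 'n::finite) chart set \<Rightarrow> ('a \<Rightarrow> (real^'n) set) \<Rightarrow>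
   ('a \<Rightarrow> real^'n \<Rightarrow> real^'n \<Rightarrow> real) \<Rightarrow> 'a set \<Rightarrow> ('a \<Rightarrow> 'a) \<Rightarrow> bool" where
  "local_isometry_on A D g W \<phi> \<longleftrightarrow> local_diffeo_on A W \<phi> \<and> isometric_on A D g W \<phi>"


section \<open>Popp's volume\<close>

text \<open>An element of the i-th tensor power of \<open>D\<^sub>q\<close> (with \<open>i \<ge> 1\<close>) is written as a formal sum of
  decomposable tensors \<open>v\<^sub>1 \<otimes> \<dots> \<otimes> v\<^sub>i\<close>, each given by the list of its factors; scalar
  coefficients are absorbed in the factors. The induced inner product and the map \<open>\<pi>\<^sub>i\<close> depend only
  on the tensor represented, so that minimizing over formal sums is minimizing over tensors.\<close>

definition tensor_inner :: "('v \<Rightarrow> 'v \<Rightarrow> real) \<Rightarrow> 'v list list \<Rightarrow> 'v list list \<Rightarrow> real" where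
  "tensor_inner B Z W = (\<Sum>v\<leftarrow>Z. \<Sum>w\<leftarrow>W. \<Prod>j<length v. B (v ! j) (w ! j))"

definition tensor_norm :: "('v \<Rightarrow> 'v \<Rightarrow> real) \<Rightarrow> 'v list list \<Rightarrow> real" where
  "tensor_norm B Z = sqrt (tensor_inner B Z Z)"

text \<open>The graph of \<open>\<pi>\<^sub>i\<close>: the class of \<open>Y\<close> modulo \<open>D\<^bsup>i-1\<^esup>\<^sub>q\<close> is \<open>\<pi>\<^sub>i(Z)\<close>, computed with arbitrary
  local sections \<open>V\<^sub>j\<close> extending the factors occurring in \<open>Z\<close>.\<close>

definition popp_map ::
  "('a::topological_space, 'n::finite) chart set \<Rightarrow> ('a \<Rightarrow> (real^'n) set) \<Rightarrow> nat \<Rightarrow> 'a \<Rightarrow>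
   (real^'n) list list \<Rightarrow> real^'n \<Rightarrow> bool" where
  "popp_map A D i q Z Y \<longleftrightarrow> (\<exists>U Vss. open U \<and> q \<in> U \<and>
     (\<forall>Vs\<in>set Vss. length Vs = i \<and> set Vs \<subseteq> sections A D U) \<and>
     Z = map (map (\<lambda>V. V q)) Vss \<and>
     (\<Sum>Vs\<leftarrow>Vss. nested_bracket A Vs q) - Y \<in> flag A D (i - 1) q)"

text \<open>The norm on \<open>D\<^sup>i\<^sub>q / D\<^bsup>i-1\<^esup>\<^sub>q\<close>, as a function of a representative. The infimum is attained.\<close>

definition popp_norm ::
  "('a::topological_space, 'n::finite) chart set \<Rightarrow> ('a \<Rightarrow> (real^'n) set) \<Rightarrow>
   ('a \<Rightarrow> real^'n \<Rightarrow> real^'n \<Rightarrow> real) \<Rightarrow> nat \<Rightarrow> 'a \<Rightarrow> real^'n \<Rightarrow> real" where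
  "popp_norm A D g i q Y = Inf {tensor_norm (g q) Z | Z. popp_map A D i q Z Y}"

text \<open>Inner products on a quotient space \<open>F/E\<close>, as functions of representatives.\<close>

definition quotient_inner_product :: "'v::real_vector set \<Rightarrow> 'v set \<Rightarrow> ('v \<Rightarrow> 'v \<Rightarrow> real) \<Rightarrow> bool" where
  "quotient_inner_product F E B \<longleftrightarrow>
     (\<forall>x\<in>F. \<forall>y\<in>F. B x y = B y x) \<and>
     (\<forall>x\<in>F. \<forall>y\<in>F. \<forall>z\<in>F. B (x + y) z = B x z + B y z) \<and>
     (\<forall>r. \<forall>x\<in>F. \<forall>y\<in>F. B (r *\<^sub>R x) y = r * B x y) \<and>
     (\<forall>x\<in>E. \<forall>y\<in>F. B x y = 0) \<and>
     (\<forall>x\<in>F - E. B x x > 0)"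

definition popp_inner_product ::
  "('a::topological_space, 'n::finite) chart set \<Rightarrow> ('a \<Rightarrow> (real^'n) set) \<Rightarrow>
   ('a \<Rightarrow> real^'n \<Rightarrow> real^'n \<Rightarrow> real) \<Rightarrow> 'a \<Rightarrow> (nat \<Rightarrow> real^'n \<Rightarrow> real^'n \<Rightarrow> real) \<Rightarrow> bool" where
  "popp_inner_product A D g q B \<longleftrightarrow>
     (\<forall>i\<ge>1. quotient_inner_product (flag A D i q) (flag A D (i - 1) q) (B i) \<and>
        (\<forall>Y\<in>flag A D i q. B i Y Y = (popp_norm A D g i q Y)\<^sup>2))"

text \<open>A nonzero vector \<open>v\<close> of degree \<open>i\<close>, i.e. lying in \<open>D\<^sup>i\<^sub>q\<close> but not in \<open>D\<^bsup>i-1\<^esup>\<^sub>q\<close>, represents its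
  class in \<open>D\<^sup>i\<^sub>q / D\<^bsup>i-1\<^esup>\<^sub>q\<close>, a summand of \<open>gr\<^sub>q(D)\<close>; \<open>gr_inner\<close> is the inner product of the orthogonal
  direct sum on such classes. The quotients beyond the step vanish and contribute nothing.\<close>

definition degree ::
  "('a::topological_space, 'n::finite) chart set \<Rightarrow> ('a \<Rightarrow> (real^'n) set) \<Rightarrow> 'a \<Rightarrow> real^'n \<Rightarrow> nat" where
  "degree A D q v = (LEAST i. v \<in> flag A D i q)"

definition gr_inner ::
  "('a::topological_space, 'n::finite) chart set \<Rightarrow> ('a \<Rightarrow> (real^'n) set) \<Rightarrow> 'a \<Rightarrow>
   (nat \<Rightarrow> real^'n \<Rightarrow> real^'n \<Rightarrow> real) \<Rightarrow> real^'n \<Rightarrow> real^'n \<Rightarrow> real" where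
  "gr_inner A D q B v w =
     (if degree A D q v = degree A D q w then B (degree A D q v) v w else 0)"

text \<open>Bases of the tangent space containing a basis of each \<open>D\<^sup>i\<^sub>q\<close>. Only the enumeration by
  increasing degree is dropped, which affects n-forms by a sign.\<close>

definition adapted_basis ::
  "('a::topological_space, 'n::finite) chart set \<Rightarrow> ('a \<Rightarrow> (real^'n) set) \<Rightarrow> 'a \<Rightarrow> ('n \<Rightarrow> real^'n) \<Rightarrow> bool" where
  "adapted_basis A D q v \<longleftrightarrow> inj v \<and> independent (range v) \<and>
     (\<forall>i. span {v a | a. v a \<in> flag A D i q} = flag A D i q)"

text \<open>\<open>\<omega> = \<plusminus>\<mu>\<^sub>q \<circ> \<theta>\<^sub>q\<close>: the classes of \<open>u\<close> are an orthonormal basis of \<open>gr\<^sub>q(D)\<close>, whose dual basis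
  is obtained by taking inner products, so that \<open>\<mu>\<^sub>q \<circ> \<theta>\<^sub>q\<close> evaluated on an adapted basis \<open>v\<close> is
  the determinant of the inner products of the classes of \<open>u\<close> and \<open>v\<close>.\<close>

definition popp_form_at ::
  "('a::topological_space, 'n::finite) chart set \<Rightarrow> ('a \<Rightarrow> (real^'n) set) \<Rightarrow>
   ('a \<Rightarrow> real^'n \<Rightarrow> real^'n \<Rightarrow> real) \<Rightarrow> 'a \<Rightarrow> (('n \<Rightarrow> real^'n) \<Rightarrow> real) \<Rightarrow> bool" where
  "popp_form_at A D g q \<omega> \<longleftrightarrow>
     (\<exists>B u. \<exists>s\<in>{1, -1}. popp_inner_product A D g q B \<and> adapted_basis A D q u \<and>
        (\<forall>a b. gr_inner A D q B (u a) (u b) = (if a = b then 1 else 0)) \<and>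
        (\<forall>v. adapted_basis A D q v \<longrightarrow>
           \<omega> v = s * det (\<chi> a b. gr_inner A D q B (u a) (v b))))"

text \<open>Smoothness makes the pointwise signs consistent; on a connected manifold this determines
  the form up to a global sign, i.e. up to the choice of an orientation.\<close>

definition popp_volume ::
  "('a::topological_space, 'n::finite) chart set \<Rightarrow> ('a \<Rightarrow> (real^'n) set) \<Rightarrow>
   ('a \<Rightarrow> real^'n \<Rightarrow> real^'n \<Rightarrow> real) \<Rightarrow> ('a, 'n) form \<Rightarrow> bool" where
  "popp_volume A D g P \<longleftrightarrow> smooth_form A P \<and> (\<forall>q. popp_form_at A D g q (P q))"

end

theory Submission
  imports Defs
begin

text \<open>Popp's volume is built from the distribution, its inner product and Lie brackets alone, so a
  local isometry \<open>\<phi>\<close> respects every ingredient. Lie brackets commute with pushing vector fields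
  forward (\<open>bracket_related\<close>); in coordinates this is the product rule together with the symmetry of
  the second derivative (\<open>bracket_of_related_fields\<close>). Hence the differential of \<open>\<phi>\<close> maps the flag
  onto the flag (\<open>push_flag\<close>) and preserves the minimal norm on the quotients (\<open>popp_norm_push\<close>), and
  by polarization their inner products (\<open>gr_inner_push\<close>). A top degree form is determined up to a
  scalar, so \<open>\<phi>\<^sup>*P = c P\<close> at each point, and comparing orthonormal adapted bases at the two points
  gives \<open>c\<^sup>2 = 1\<close> (\<open>popp_form_push\<close>). The sign is \<open>+\<close> exactly when \<open>\<phi>\<close> preserves orientation, so
  the nonzero multiples of \<open>P\<close> are invariant under orientation preserving local isometries.

  Conversely, let the volume form \<open>\<mu> = f P\<close> be invariant under the global isometries that preserve
  orientation. For a global isometry the sign above depends continuously on the point, hence is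
  constant on the connected manifold (\<open>isometry_orientation_dichotomy\<close>). The function \<open>f\<close> is
  invariant under the isometries of sign \<open>+\<close>; these form a subgroup of index at most two in a
  transitive group, so \<open>f\<close> has at most two values and, being continuous, is constant
  (\<open>invariant_volume_form\<close>).\<close>

section \<open>Calculus of smooth maps\<close>

lemma frechet_derivative_cong_open:
  assumes "open S" "x \<in> S" "\<And>y. y \<in> S \<Longrightarrow> f y = g y"
  shows "frechet_derivative f (at x) = frechet_derivative g (at x)"
proof -
  have "(f has_derivative D) (at x) \<longleftrightarrow> (g has_derivative D) (at x)" for D
    using has_derivative_transform_within_open[OF _ assms(1,2)] assms(3) by metis
  then show ?thesis unfolding frechet_derivative_def by presburger
qed

lemma differentiable_cong_open:
  assumes "open S" "x \<in> S" "\<And>y. y \<in> S \<Longrightarrow> f y = g y" "f differentiable (at x)"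
  shows "g differentiable (at x)"
proof -
  obtain D where "(f has_derivative D) (at x)" using assms(4) unfolding differentiable_def ..
  then have "(g has_derivative D) (at x)"
    by (rule has_derivative_transform_within_open[OF _ assms(1,2)]) (rule assms(3))
  then show ?thesis by (rule differentiableI)
qed

lemma Ck_on_cong:
  assumes "open S" "\<And>x. x \<in> S \<Longrightarrow> f x = g x" "Ck_on k S f"
  shows "Ck_on k S g"
  using assms(2,3)
proof (induction k arbitrary: f g)
  case 0
  then show ?case by (simp cong: continuous_on_cong)
next
  case (Suc k)
  have "Ck_on k S (\<lambda>x. frechet_derivative g (at x) v)" for v
  proof (rule Suc.IH)
    show "Ck_on k S (\<lambda>x. frechet_derivative f (at x) v)" using Suc.prems(2) by simp
  qed (metis frechet_derivative_cong_open[OF assms(1)] Suc.prems(1))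
  moreover have "g differentiable (at x)" if "x \<in> S" for x
    using Suc.prems that by (intro differentiable_cong_open[OF assms(1) that, of f g]) simp_all
  ultimately show ?case by simp
qed

lemma Ck_on_subset:
  assumes "S \<subseteq> T" "Ck_on k T f"
  shows "Ck_on k S f"
  using assms(2)
proof (induction k arbitrary: f)
  case 0
  then show ?case using continuous_on_subset[OF _ assms(1)] by simp
next
  case (Suc k)
  then show ?case using assms(1) by (simp add: subset_iff)
qed

lemma Ck_on_locally:
  assumes "\<And>x. x \<in> S \<Longrightarrow> \<exists>U. open U \<and> x \<in> U \<and> Ck_on k U f"
  shows "Ck_on k S f"
  using assms
proof (induction k arbitrary: f)
  case 0
  show ?case
    unfolding Ck_on.simps
  proof (rule continuous_at_imp_continuous_on, rule ballI)
    fix x assume "x \<in> S"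
    then obtain U where "open U" "x \<in> U" "continuous_on U f" using 0 by auto
    then show "isCont f x" by (simp add: continuous_on_eq_continuous_at)
  qed
next
  case (Suc k)
  have "f differentiable (at x)" if "x \<in> S" for x
    using Suc.prems[OF that] by auto
  moreover have "Ck_on k S (\<lambda>x. frechet_derivative f (at x) v)" for v
    by (rule Suc.IH) (use Suc.prems in \<open>metis Ck_on.simps(2)\<close>)
  ultimately show ?case by simp
qed

lemma Ck_on_lower: "Ck_on (Suc k) S f \<Longrightarrow> Ck_on k S f"
proof (induction k arbitrary: f)
  case 0
  then show ?case
    by (auto intro!: continuous_at_imp_continuous_on differentiable_imp_continuous_within)
next
  case (Suc k)
  then show ?case by (meson Ck_on.simps(2))
qed

lemma Ck_on_imp_continuous_on: "Ck_on k S f \<Longrightarrow> continuous_on S f"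
proof (induction k)
  case (Suc k) then show ?case using Ck_on_lower by blast
qed simp

lemma continuous_on_locally_open:
  fixes f :: "'b::topological_space \<Rightarrow> 'c::topological_space"
  assumes "\<And>q. q \<in> W \<Longrightarrow> \<exists>N. open N \<and> q \<in> N \<and> continuous_on N f"
  shows "continuous_on W f"
proof -
  let ?\<N> = "{N. open N \<and> continuous_on N f}"
  have "continuous_on (\<Union>N\<in>?\<N>. N) f" by (rule continuous_on_open_UN) auto
  moreover have "W \<subseteq> (\<Union>N\<in>?\<N>. N)" using assms by blast
  ultimately show ?thesis by (rule continuous_on_subset)
qed

lemma Ck_on_const: "Ck_on k S (\<lambda>x. c)"
  by (induction k arbitrary: c) simp_all

lemma frechet_derivative_eqI:
  "(f has_derivative f') (at x) \<Longrightarrow> frechet_derivative f (at x) v = f' v"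
  by (drule frechet_derivative_at) simp

text \<open>The recursive clause of \<open>Ck_on\<close> speaks of \<open>frechet_derivative\<close>; with this rule a derivative
  obtained from the differentiation rules can be used instead.\<close>
lemma Ck_on_SucI:
  assumes "open S" "\<And>x. x \<in> S \<Longrightarrow> (f has_derivative D x) (at x)" "\<And>v. Ck_on k S (\<lambda>x. D x v)"
  shows "Ck_on (Suc k) S f"
proof -
  have "f differentiable (at x)" if "x \<in> S" for x
    using assms(2)[OF that] by (rule differentiableI)
  moreover have "Ck_on k S (\<lambda>x. frechet_derivative f (at x) v)" for v
    by (rule Ck_on_cong[OF assms(1) _ assms(3)]) (simp add: frechet_derivative_eqI[OF assms(2)])
  ultimately show ?thesis by simp
qed

lemma Ck_on_has_derivative:
  "Ck_on (Suc k) S f \<Longrightarrow> x \<in> S \<Longrightarrow> (f has_derivative frechet_derivative f (at x)) (at x)"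
  by (simp add: frechet_derivative_works[symmetric])

lemma Ck_on_bounded_linear:
  assumes "bounded_linear L" "open S" "Ck_on k S f"
  shows "Ck_on k S (\<lambda>x. L (f x))"
  using assms(3)
proof (induction k arbitrary: f)
  case 0
  then show ?case by (simp add: bounded_linear.continuous_on[OF assms(1)])
next
  case (Suc k)
  show ?case
  proof (rule Ck_on_SucI[OF assms(2)])
    show "((\<lambda>x. L (f x)) has_derivative (\<lambda>v. L (frechet_derivative f (at x) v))) (at x)"
      if "x \<in> S" for x
      using Suc.prems[THEN Ck_on_has_derivative, OF that]
      by (intro bounded_linear.has_derivative[OF assms(1)])
    fix v
    show "Ck_on k S (\<lambda>x. L (frechet_derivative f (at x) v))"
      using Suc by simp
  qed
qed

lemma Ck_on_add:
  assumes "open S" "Ck_on k S f" "Ck_on k S g"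
  shows "Ck_on k S (\<lambda>x. f x + g x)"
  using assms(2,3)
proof (induction k arbitrary: f g)
  case 0
  then show ?case by (simp add: continuous_on_add)
next
  case (Suc k)
  show ?case
  proof (rule Ck_on_SucI[OF assms(1)])
    show "((\<lambda>x. f x + g x) has_derivative
      (\<lambda>v. frechet_derivative f (at x) v + frechet_derivative g (at x) v)) (at x)"
      if "x \<in> S" for x
      using Suc.prems[THEN Ck_on_has_derivative, OF that]
      by (intro has_derivative_add)
    fix v
    show "Ck_on k S (\<lambda>x. frechet_derivative f (at x) v + frechet_derivative g (at x) v)"
      using Suc by simp
  qed
qed

lemma Ck_on_scaleR:
  assumes "open S" "Ck_on k S f" "Ck_on k S g"
  shows "Ck_on k S (\<lambda>x. f x *\<^sub>R g x)"
  using assms(2,3)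
proof (induction k arbitrary: f g)
  case 0
  then show ?case by (simp add: continuous_on_scaleR)
next
  case (Suc k)
  show ?case
  proof (rule Ck_on_SucI[OF assms(1)])
    show "((\<lambda>x. f x *\<^sub>R g x) has_derivative
      (\<lambda>v. f x *\<^sub>R frechet_derivative g (at x) v + frechet_derivative f (at x) v *\<^sub>R g x)) (at x)"
      if "x \<in> S" for x
      using Suc.prems[THEN Ck_on_has_derivative, OF that]
      by (intro has_derivative_scaleR)
    fix v
    show "Ck_on k S (\<lambda>x. f x *\<^sub>R frechet_derivative g (at x) v + frechet_derivative f (at x) v *\<^sub>R g x)"
      using Suc.prems Ck_on_lower[OF Suc.prems(1)] Ck_on_lower[OF Suc.prems(2)]
      by (intro Ck_on_add assms(1) Suc.IH) auto
  qed
qed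

lemma Ck_on_sum:
  assumes "open S" "finite I" "\<And>i. i \<in> I \<Longrightarrow> Ck_on k S (f i)"
  shows "Ck_on k S (\<lambda>x. \<Sum>i\<in>I. f i x)"
  using assms(2,3)
  by (induction I rule: finite_induct) (simp_all add: Ck_on_const Ck_on_add[OF assms(1)])

lemma linear_expand_Basis:
  fixes L :: "'e::euclidean_space \<Rightarrow> 'f::real_vector"
  assumes "linear L"
  shows "L v = (\<Sum>b\<in>Basis. (v \<bullet> b) *\<^sub>R L b)"
proof -
  have "L v = L (\<Sum>b\<in>Basis. (v \<bullet> b) *\<^sub>R b)" by (simp add: euclidean_representation)
  then show ?thesis by (simp add: linear_sum[OF assms] linear_cmul[OF assms])
qed

text \<open>Expanding the argument in the basis turns the application of a varying linear map into a sum of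
  products of maps of class C^k.\<close>
lemma Ck_on_apply_linear:
  fixes f :: "'e::real_normed_vector \<Rightarrow> 'f::euclidean_space \<Rightarrow> 'h::real_normed_vector"
  assumes "open S" "\<And>x. x \<in> S \<Longrightarrow> linear (f x)" "\<And>b. Ck_on k S (\<lambda>x. f x b)" "Ck_on k S X"
  shows "Ck_on k S (\<lambda>x. f x (X x))"
proof (rule Ck_on_cong[OF assms(1)])
  show "Ck_on k S (\<lambda>x. \<Sum>b\<in>Basis. (X x \<bullet> b) *\<^sub>R f x b)"
    by (intro Ck_on_sum Ck_on_scaleR assms Ck_on_bounded_linear[OF bounded_linear_inner_left]) auto
qed (rule linear_expand_Basis[OF assms(2), symmetric])

text \<open>The induction hypothesis applies to \<open>z \<mapsto> Df(z) b\<close> for each fixed \<open>b\<close>, which is enough to treat the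
  derivative \<open>Df(g x) (Dg(x) v)\<close> by expanding \<open>Dg(x) v\<close> in the basis.\<close>
lemma Ck_on_compose:
  fixes f :: "'f::euclidean_space \<Rightarrow> 'h::real_normed_vector"
    and g :: "'e::real_normed_vector \<Rightarrow> 'f"
  assumes "open S" "g ` S \<subseteq> T" "Ck_on k T f" "Ck_on k S g"
  shows "Ck_on k S (\<lambda>x. f (g x))"
  using assms(3,4)
proof (induction k arbitrary: f)
  case 0
  then show ?case using continuous_on_compose2[OF _ _ assms(2)] by simp
next
  case (Suc k)
  have f: "(f has_derivative frechet_derivative f (at (g x))) (at (g x))" if "x \<in> S" for x
    using Ck_on_has_derivative[OF Suc.prems(1)] assms(2) that by blast
  show ?case
  proof (rule Ck_on_SucI[OF assms(1)])
    show "((\<lambda>x. f (g x)) has_derivative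
      (\<lambda>v. frechet_derivative f (at (g x)) (frechet_derivative g (at x) v))) (at x)"
      if "x \<in> S" for x
      using has_derivative_compose[OF Ck_on_has_derivative[OF Suc.prems(2) that] f[OF that]] .
    fix v
    show "Ck_on k S (\<lambda>x. frechet_derivative f (at (g x)) (frechet_derivative g (at x) v))"
    proof (rule Ck_on_apply_linear[OF assms(1)])
      show "linear (frechet_derivative f (at (g x)))" if "x \<in> S" for x
        using f[OF that] has_derivative_linear by blast
      show "Ck_on k S (\<lambda>x. frechet_derivative f (at (g x)) b)" for b
        using Suc.prems Ck_on_lower[OF Suc.prems(2)] by (intro Suc.IH) auto
    qed (use Suc.prems in simp)
  qed
qed

lemma smooth_onD: "smooth_on S f \<Longrightarrow> Ck_on k S f"
  by (simp add: smooth_on_def)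

lemma smooth_on_differentiable: "smooth_on S f \<Longrightarrow> x \<in> S \<Longrightarrow> f differentiable (at x)"
  using smooth_onD[of S f "Suc 0"] by simp

lemma smooth_on_has_derivative:
  "smooth_on S f \<Longrightarrow> x \<in> S \<Longrightarrow> (f has_derivative frechet_derivative f (at x)) (at x)"
  using smooth_on_differentiable frechet_derivative_works by blast

lemma smooth_on_linear_derivative:
  "smooth_on S f \<Longrightarrow> x \<in> S \<Longrightarrow> linear (frechet_derivative f (at x))"
  using smooth_on_has_derivative has_derivative_linear by blast

lemma smooth_on_derivative: "smooth_on S f \<Longrightarrow> smooth_on S (\<lambda>x. frechet_derivative f (at x) v)"
  unfolding smooth_on_def
proof
  fix k assume "\<forall>k. Ck_on k S f"
  then have "Ck_on (Suc k) S f" ..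
  then show "Ck_on k S (\<lambda>x. frechet_derivative f (at x) v)" by simp
qed

lemma smooth_on_continuous_on: "smooth_on S f \<Longrightarrow> continuous_on S f"
  by (rule Ck_on_imp_continuous_on[OF smooth_onD[of _ _ 0]])

lemma smooth_on_cong:
  "open S \<Longrightarrow> (\<And>x. x \<in> S \<Longrightarrow> f x = g x) \<Longrightarrow> smooth_on S f \<Longrightarrow> smooth_on S g"
  by (simp add: smooth_on_def Ck_on_cong[of S f g])

lemma smooth_on_subset: "smooth_on T f \<Longrightarrow> S \<subseteq> T \<Longrightarrow> smooth_on S f"
  by (simp add: smooth_on_def Ck_on_subset[of _ T])

lemma smooth_on_locally:
  assumes "\<And>x. x \<in> S \<Longrightarrow> \<exists>U. open U \<and> x \<in> U \<and> smooth_on U f"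
  shows "smooth_on S f"
  unfolding smooth_on_def
  by (intro allI Ck_on_locally) (meson assms smooth_onD)

lemma smooth_on_bounded_linear:
  "bounded_linear L \<Longrightarrow> open S \<Longrightarrow> smooth_on S f \<Longrightarrow> smooth_on S (\<lambda>x. L (f x))"
  by (simp add: smooth_on_def Ck_on_bounded_linear)

lemma smooth_on_diff:
  assumes "open S" "smooth_on S f" "smooth_on S g"
  shows "smooth_on S (\<lambda>x. f x - g x)"
proof -
  have "Ck_on k S (\<lambda>x. f x + - g x)" for k
    by (intro Ck_on_add assms(1) smooth_onD[OF assms(2)]
        Ck_on_bounded_linear[OF bounded_linear_minus[OF bounded_linear_ident]] smooth_onD[OF assms(3)])
  then show ?thesis by (simp add: smooth_on_def)
qed

lemma smooth_on_compose:
  fixes f :: "'f::euclidean_space \<Rightarrow> 'h::real_normed_vector"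
  assumes "open S" "g ` S \<subseteq> T" "smooth_on T f" "smooth_on S g"
  shows "smooth_on S (\<lambda>x. f (g x))"
  unfolding smooth_on_def
  using Ck_on_compose[OF assms(1,2) smooth_onD[OF assms(3)] smooth_onD[OF assms(4)]] by (rule allI)

lemma smooth_on_apply_derivative:
  fixes f :: "'e::euclidean_space \<Rightarrow> 'h::real_normed_vector"
  assumes "open S" "smooth_on S f" "smooth_on S X"
  shows "smooth_on S (\<lambda>x. frechet_derivative f (at x) (X x))"
  unfolding smooth_on_def
  by (rule allI, rule Ck_on_apply_linear[OF assms(1) smooth_on_linear_derivative[OF assms(2)]
      smooth_onD[OF smooth_on_derivative[OF assms(2)]] smooth_onD[OF assms(3)]])

section \<open>Symmetry of the second derivative\<close>

lemma has_derivative_along_line: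
  fixes f :: "'e::real_normed_vector \<Rightarrow> real"
  assumes "f differentiable (at (p + s *\<^sub>R u))"
  shows "((\<lambda>s. f (p + s *\<^sub>R u)) has_real_derivative frechet_derivative f (at (p + s *\<^sub>R u)) u) (at s)"
proof -
  let ?D = "frechet_derivative f (at (p + s *\<^sub>R u))"
  have D: "(f has_derivative ?D) (at (p + s *\<^sub>R u))"
    by (rule assms[unfolded frechet_derivative_works])
  have "((\<lambda>s. p + s *\<^sub>R u) has_derivative (\<lambda>h. h *\<^sub>R u)) (at s)"
    by (auto intro!: derivative_eq_intros)
  from has_derivative_compose[OF this D]
  have "((\<lambda>s. f (p + s *\<^sub>R u)) has_derivative (\<lambda>h. ?D (h *\<^sub>R u))) (at s)" .
  moreover have "?D (h *\<^sub>R u) = ?D u * h" for h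
    using has_derivative_linear[OF D] by (simp add: linear_cmul)
  ultimately show ?thesis by (simp add: has_field_derivative_def)
qed

text \<open>The mean value theorem is applied twice: to \<open>s \<mapsto> f (x + t v + s u) - f (x + s u)\<close>, and then to the
  difference of derivatives that it produces, as a function of the multiple of \<open>v\<close>.\<close>
lemma second_difference_mean_value:
  fixes f :: "'e::real_normed_vector \<Rightarrow> real"
  assumes f: "smooth_on (ball x \<delta>) f" and t: "t > 0" "t * (norm u + norm v) < \<delta>"
  shows "\<exists>y\<in>ball x \<delta>. f (x + t *\<^sub>R u + t *\<^sub>R v) - f (x + t *\<^sub>R u) - f (x + t *\<^sub>R v) + f x
     = t * (t * frechet_derivative (\<lambda>z. frechet_derivative f (at z) u) (at y) v)"
proof -
  have in_ball: "x + r *\<^sub>R v + s *\<^sub>R u \<in> ball x \<delta>" if "0 \<le> s" "s \<le> t" "0 \<le> r" "r \<le> t" for r s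
  proof -
    have "norm (r *\<^sub>R v + s *\<^sub>R u) \<le> r * norm v + s * norm u"
      using that norm_triangle_ineq[of "r *\<^sub>R v" "s *\<^sub>R u"] by simp
    also have "\<dots> \<le> t * norm v + t * norm u"
      using that by (intro add_mono mult_right_mono) auto
    also have "\<dots> < \<delta>" using t by (simp add: algebra_simps)
    finally have "dist (x + (r *\<^sub>R v + s *\<^sub>R u)) x < \<delta>" by (simp add: dist_norm)
    then show ?thesis by (simp only: mem_ball dist_commute add.assoc)
  qed
  let ?g = "\<lambda>s. f (x + t *\<^sub>R v + s *\<^sub>R u) - f (x + s *\<^sub>R u)"
  let ?g' = "\<lambda>s. frechet_derivative f (at (x + t *\<^sub>R v + s *\<^sub>R u)) u - frechet_derivative f (at (x + s *\<^sub>R u)) u"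
  have "DERIV ?g s :> ?g' s" if "0 \<le> s" "s \<le> t" for s
    using that in_ball[of s t] in_ball[of s 0] t smooth_on_differentiable[OF f]
    by (intro DERIV_diff has_derivative_along_line) auto
  from MVT2[OF \<open>t > 0\<close> this] obtain \<xi> where \<xi>: "0 < \<xi>" "\<xi> < t" "?g t - ?g 0 = t * ?g' \<xi>"
    by auto
  let ?h = "\<lambda>r. frechet_derivative f (at (x + \<xi> *\<^sub>R u + r *\<^sub>R v)) u"
  let ?h' = "\<lambda>r. frechet_derivative (\<lambda>z. frechet_derivative f (at z) u) (at (x + \<xi> *\<^sub>R u + r *\<^sub>R v)) v"
  have "DERIV ?h r :> ?h' r" if "0 \<le> r" "r \<le> t" for r
    using that in_ball[of \<xi> r] \<xi> smooth_on_differentiable[OF smooth_on_derivative[OF f]]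
    by (intro has_derivative_along_line) (auto simp: add_ac)
  from MVT2[OF \<open>t > 0\<close> this] obtain \<eta> where \<eta>: "0 < \<eta>" "\<eta> < t" "?h t - ?h 0 = t * ?h' \<eta>"
    by auto
  have "?g' \<xi> = ?h t - ?h 0" by (simp add: add_ac)
  then have "?g t - ?g 0 = t * (t * ?h' \<eta>)" using \<xi>(3) \<eta>(3) by simp
  moreover have "?g t - ?g 0 = f (x + t *\<^sub>R u + t *\<^sub>R v) - f (x + t *\<^sub>R u) - f (x + t *\<^sub>R v) + f x"
    by (simp add: add_ac)
  moreover have "x + \<xi> *\<^sub>R u + \<eta> *\<^sub>R v \<in> ball x \<delta>"
    using in_ball[of \<xi> \<eta>] \<xi> \<eta> by (simp add: add_ac)
  ultimately show ?thesis by metis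
qed

text \<open>The second difference is symmetric in \<open>u\<close> and \<open>v\<close>, so by the mean value formula the two mixed
  derivatives take a common value at points arbitrarily close to \<open>x\<close>; both are continuous.\<close>
lemma second_derivative_symmetric_real:
  fixes f :: "'e::real_normed_vector \<Rightarrow> real"
  assumes S: "open S" "x \<in> S" and f: "smooth_on S f"
  shows "frechet_derivative (\<lambda>z. frechet_derivative f (at z) u) (at x) v =
         frechet_derivative (\<lambda>z. frechet_derivative f (at z) v) (at x) u"
proof (rule ccontr)
  let ?A = "\<lambda>y. frechet_derivative (\<lambda>z. frechet_derivative f (at z) u) (at y) v"
  let ?B = "\<lambda>y. frechet_derivative (\<lambda>z. frechet_derivative f (at z) v) (at y) u"
  assume ne: "?A x \<noteq> ?B x"
  define e where "e = \<bar>?A x - ?B x\<bar> / 2"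
  have e: "e > 0" using ne by (simp add: e_def)
  have cont: "isCont ?A x" "isCont ?B x"
    using S smooth_on_continuous_on[OF smooth_on_derivative[OF smooth_on_derivative[OF f]]]
    by (auto simp: continuous_on_eq_continuous_at)
  obtain d1 where d1: "d1 > 0" "\<And>y. dist y x < d1 \<Longrightarrow> \<bar>?A y - ?A x\<bar> < e"
    using cont(1)[unfolded continuous_at_eps_delta, rule_format, OF e] by (auto simp: dist_real_def)
  obtain d2 where d2: "d2 > 0" "\<And>y. dist y x < d2 \<Longrightarrow> \<bar>?B y - ?B x\<bar> < e"
    using cont(2)[unfolded continuous_at_eps_delta, rule_format, OF e] by (auto simp: dist_real_def)
  obtain d3 where d3: "d3 > 0" "ball x d3 \<subseteq> S"
    using S open_contains_ball by blast
  define \<delta> where "\<delta> = min d1 (min d2 d3)"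
  have \<delta>: "\<delta> > 0" "\<delta> \<le> d1" "\<delta> \<le> d2" "\<delta> \<le> d3" using d1 d2 d3 by (auto simp: \<delta>_def)
  have sm: "smooth_on (ball x \<delta>) f"
    by (rule smooth_on_subset[OF f order_trans[OF subset_ball[OF \<delta>(4)] d3(2)]])
  \<comment> \<open>This \<open>t\<close> keeps the parallelogram spanned by \<open>t u\<close> and \<open>t v\<close> inside the ball; the \<open>+ 1\<close> covers \<open>u = v = 0\<close>.\<close>
  define t where "t = \<delta> / (2 * (norm u + norm v + 1))"
  have pos: "norm u + norm v + 1 > 0" by (simp add: add_nonneg_pos)
  have t: "t > 0" using \<delta> pos by (simp add: t_def)
  have "t * (norm u + norm v) < t * (2 * (norm u + norm v + 1))"
    using t by (intro mult_strict_left_mono) (auto simp: add_nonneg_pos)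
  also have "\<dots> = \<delta>" using pos by (simp add: t_def)
  finally have tl: "t * (norm u + norm v) < \<delta>" .
  obtain y1 where y1: "y1 \<in> ball x \<delta>"
    "f (x + t *\<^sub>R u + t *\<^sub>R v) - f (x + t *\<^sub>R u) - f (x + t *\<^sub>R v) + f x = t * (t * ?A y1)"
    using second_difference_mean_value[OF sm t tl] by blast
  obtain y2 where y2: "y2 \<in> ball x \<delta>"
    "f (x + t *\<^sub>R v + t *\<^sub>R u) - f (x + t *\<^sub>R v) - f (x + t *\<^sub>R u) + f x = t * (t * ?B y2)"
    using second_difference_mean_value[OF sm t, of v u] tl by (auto simp: add.commute)
  have "t * (t * ?A y1) = t * (t * ?B y2)"
    unfolding y1(2)[symmetric] y2(2)[symmetric] by (simp add: add_ac)
  then have "?A y1 = ?B y2" using t mult_left_cancel less_irrefl by metis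
  moreover have "\<bar>?A y1 - ?A x\<bar> < e" "\<bar>?B y2 - ?B x\<bar> < e"
    using d1(2)[of y1] d2(2)[of y2] y1(1) y2(1) \<delta> by (auto simp: dist_commute)
  ultimately have "\<bar>?A x - ?B x\<bar> < e + e" by arith
  then show False by (simp add: e_def)
qed

lemma frechet_derivative_inner:
  assumes "f differentiable (at x)"
  shows "frechet_derivative (\<lambda>z. f z \<bullet> b) (at x) v = frechet_derivative f (at x) v \<bullet> b"
  by (rule frechet_derivative_eqI, rule has_derivative_inner_left)
    (rule assms[unfolded frechet_derivative_works])

lemma second_derivative_symmetric:
  fixes f :: "'e::real_normed_vector \<Rightarrow> 'f::euclidean_space"
  assumes S: "open S" "x \<in> S" and f: "smooth_on S f"
  shows "frechet_derivative (\<lambda>z. frechet_derivative f (at z) u) (at x) v =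
         frechet_derivative (\<lambda>z. frechet_derivative f (at z) v) (at x) u"
proof (rule euclidean_eqI)
  fix b :: 'f
  have fb: "smooth_on S (\<lambda>z. f z \<bullet> b)"
    by (intro smooth_on_bounded_linear[OF bounded_linear_inner_left] S f)
  have "frechet_derivative (\<lambda>z. frechet_derivative f (at z) w) (at x) w' \<bullet> b =
        frechet_derivative (\<lambda>z. frechet_derivative (\<lambda>z. f z \<bullet> b) (at z) w) (at x) w'" for w w'
  proof -
    have "frechet_derivative (\<lambda>z. frechet_derivative f (at z) w) (at x) w' \<bullet> b =
      frechet_derivative (\<lambda>z. frechet_derivative f (at z) w \<bullet> b) (at x) w'"
      by (rule frechet_derivative_inner[OF smooth_on_differentiable[OF smooth_on_derivative[OF f] S(2)], symmetric])
    also have "\<dots> = frechet_derivative (\<lambda>z. frechet_derivative (\<lambda>z. f z \<bullet> b) (at z) w) (at x) w'"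
      by (rule arg_cong[where f = "\<lambda>D. D w'"], rule frechet_derivative_cong_open[OF S])
        (rule frechet_derivative_inner[OF smooth_on_differentiable[OF f], symmetric])
    finally show ?thesis .
  qed
  then show "frechet_derivative (\<lambda>z. frechet_derivative f (at z) u) (at x) v \<bullet> b =
         frechet_derivative (\<lambda>z. frechet_derivative f (at z) v) (at x) u \<bullet> b"
    using second_derivative_symmetric_real[OF S fb] by simp
qed

section \<open>Lie brackets of related vector fields\<close>

text \<open>The product rule for \<open>X' \<circ> F = DF X\<close>. The first summand is the Hessian of \<open>F\<close> at \<open>X\<close> and \<open>v\<close>.\<close>
lemma derivative_of_related_field:
  fixes F :: "'e::euclidean_space \<Rightarrow> 'f::euclidean_space"
  assumes S: "open S" "x \<in> S" and F: "smooth_on S F"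
    and X: "X differentiable (at x)" and X': "X' differentiable (at (F x))"
    and rel: "\<And>y. y \<in> S \<Longrightarrow> X' (F y) = frechet_derivative F (at y) (X y)"
  shows "frechet_derivative X' (at (F x)) (frechet_derivative F (at x) v) =
     frechet_derivative (\<lambda>y. frechet_derivative F (at y) (X x)) (at x) v
     + frechet_derivative F (at x) (frechet_derivative X (at x) v)"
proof -
  let ?D = "\<lambda>y. frechet_derivative F (at y)"
  have 1: "((\<lambda>y. X' (F y)) has_derivative (\<lambda>v. frechet_derivative X' (at (F x)) (?D x v))) (at x)"
    by (rule has_derivative_compose[OF smooth_on_has_derivative[OF F S(2)] X'[unfolded frechet_derivative_works]])
  have DX: "(X has_derivative frechet_derivative X (at x)) (at x)"
    by (rule X[unfolded frechet_derivative_works])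
  have lin: "linear (?D y)" if "y \<in> S" for y using smooth_on_linear_derivative[OF F that] .
  have DD: "((\<lambda>y. ?D y b) has_derivative frechet_derivative (\<lambda>y. ?D y b) (at x)) (at x)" for b
    using smooth_on_has_derivative[OF smooth_on_derivative[OF F] S(2)] .
  have "((\<lambda>y. \<Sum>b\<in>Basis. (X y \<bullet> b) *\<^sub>R ?D y b) has_derivative
     (\<lambda>v. \<Sum>b\<in>Basis. (X x \<bullet> b) *\<^sub>R frechet_derivative (\<lambda>y. ?D y b) (at x) v
         + (frechet_derivative X (at x) v \<bullet> b) *\<^sub>R ?D x b)) (at x)"
    by (intro has_derivative_sum has_derivative_scaleR has_derivative_inner_left DX DD)
  then have 2: "((\<lambda>y. X' (F y)) has_derivative
     (\<lambda>v. \<Sum>b\<in>Basis. (X x \<bullet> b) *\<^sub>R frechet_derivative (\<lambda>y. ?D y b) (at x) v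
         + (frechet_derivative X (at x) v \<bullet> b) *\<^sub>R ?D x b)) (at x)"
    by (rule has_derivative_transform_within_open[OF _ S])
      (simp only: rel linear_expand_Basis[OF lin, symmetric])
  have "((\<lambda>y. \<Sum>b\<in>Basis. (X x \<bullet> b) *\<^sub>R ?D y b) has_derivative
     (\<lambda>v. \<Sum>b\<in>Basis. (X x \<bullet> b) *\<^sub>R frechet_derivative (\<lambda>y. ?D y b) (at x) v)) (at x)"
    by (intro has_derivative_sum has_derivative_scaleR_right DD)
  then have "((\<lambda>y. ?D y (X x)) has_derivative
     (\<lambda>v. \<Sum>b\<in>Basis. (X x \<bullet> b) *\<^sub>R frechet_derivative (\<lambda>y. ?D y b) (at x) v)) (at x)"
    by (rule has_derivative_transform_within_open[OF _ S])
      (simp only: linear_expand_Basis[OF lin, symmetric])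
  then have 3: "frechet_derivative (\<lambda>y. ?D y (X x)) (at x) v =
     (\<Sum>b\<in>Basis. (X x \<bullet> b) *\<^sub>R frechet_derivative (\<lambda>y. ?D y b) (at x) v)"
    by (rule frechet_derivative_eqI)
  have "frechet_derivative X' (at (F x)) (?D x v) =
     (\<Sum>b\<in>Basis. (X x \<bullet> b) *\<^sub>R frechet_derivative (\<lambda>y. ?D y b) (at x) v
         + (frechet_derivative X (at x) v \<bullet> b) *\<^sub>R ?D x b)"
    by (rule fun_cong[OF has_derivative_unique[OF 1 2]])
  then show ?thesis
    by (simp only: 3 sum.distrib linear_expand_Basis[OF lin[OF S(2)], symmetric])
qed

text \<open>The terms with second derivatives of \<open>F\<close> cancel by symmetry. This is why the coordinate formula
  for the bracket does not depend on the coordinates.\<close>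
lemma bracket_of_related_fields:
  fixes F :: "'e::euclidean_space \<Rightarrow> 'f::euclidean_space"
  assumes S: "open S" "x \<in> S" and F: "smooth_on S F"
    and X: "X differentiable (at x)" and X': "X' differentiable (at (F x))"
    and Y: "Y differentiable (at x)" and Y': "Y' differentiable (at (F x))"
    and relX: "\<And>y. y \<in> S \<Longrightarrow> X' (F y) = frechet_derivative F (at y) (X y)"
    and relY: "\<And>y. y \<in> S \<Longrightarrow> Y' (F y) = frechet_derivative F (at y) (Y y)"
  shows "frechet_derivative Y' (at (F x)) (X' (F x)) - frechet_derivative X' (at (F x)) (Y' (F x)) =
     frechet_derivative F (at x) (frechet_derivative Y (at x) (X x) - frechet_derivative X (at x) (Y x))"
  using derivative_of_related_field[OF S F X X' relX, of "Y x"]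
    derivative_of_related_field[OF S F Y Y' relY, of "X x"]
    second_derivative_symmetric[OF S F, of "X x" "Y x"]
  by (simp add: relX[OF S(2)] relY[OF S(2)] linear_diff[OF smooth_on_linear_derivative[OF F S(2)]])

section \<open>Alternating forms of top degree\<close>

lemma alternating_multilinear_linear: "alternating_multilinear \<omega> \<Longrightarrow> linear (\<lambda>x. \<omega> (v(a := x)))"
  by (simp add: alternating_multilinear_def)

lemma alternating_multilinear_repeat:
  "alternating_multilinear \<omega> \<Longrightarrow> a \<noteq> b \<Longrightarrow> v a = v b \<Longrightarrow> \<omega> v = 0"
  unfolding alternating_multilinear_def by blast

text \<open>Expand the form with the sum of the two vectors in both slots, where it vanishes.\<close>
lemma alternating_multilinear_swap:
  fixes \<omega> :: "('n::finite \<Rightarrow> real^'n) \<Rightarrow> real"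
  assumes \<omega>: "alternating_multilinear \<omega>" and ab: "a \<noteq> b"
  shows "\<omega> (v(a := v b, b := v a)) = - \<omega> v"
proof -
  let ?w = "\<lambda>x y. \<omega> (v(a := x, b := y))"
  have l1: "?w (x + x') y = ?w x y + ?w x' y" for x x' y
    using linear_add[OF alternating_multilinear_linear[OF \<omega>, of "v(b := y)" a], of x x'] ab
    by (simp add: fun_upd_twist[OF ab])
  have l2: "?w x (y + y') = ?w x y + ?w x y'" for x y y'
    using linear_add[OF alternating_multilinear_linear[OF \<omega>, of "v(a := x)" b], of y y'] by simp
  have 0: "?w x x = 0" for x
    by (rule alternating_multilinear_repeat[OF \<omega> ab]) (simp add: ab)
  have "?w (v a + v b) (v a + v b) = 0" by (rule 0)
  then have "?w (v a) (v b) + ?w (v b) (v a) = 0" unfolding l1 l2 using 0[of "v a"] 0[of "v b"] by linarith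
  then show ?thesis by simp
qed

lemma alternating_multilinear_compose_linear:
  fixes \<omega> :: "('n::finite \<Rightarrow> real^'n) \<Rightarrow> real"
  assumes \<omega>: "alternating_multilinear \<omega>" and L: "linear L"
  shows "alternating_multilinear (\<lambda>v. \<omega> (\<lambda>a. L (v a)))"
  unfolding alternating_multilinear_def
proof (intro conjI allI impI)
  fix v :: "'n \<Rightarrow> real^'n" and a
  have "(\<lambda>i. L ((v(a := x)) i)) = (\<lambda>i. L (v i))(a := L x)" for x by auto
  then show "linear (\<lambda>x. \<omega> (\<lambda>i. L ((v(a := x)) i)))"
    using linear_compose[OF L alternating_multilinear_linear[OF \<omega>, of "\<lambda>i. L (v i)" a]]
    by (simp add: comp_def)
next
  fix v :: "'n \<Rightarrow> real^'n" and a b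
  assume "a \<noteq> b \<and> v a = v b"
  then show "\<omega> (\<lambda>a. L (v a)) = 0" by (intro alternating_multilinear_repeat[OF \<omega>, of a b]) auto
qed

abbreviation std_frame :: "'n::finite \<Rightarrow> real^'n" where
  "std_frame \<equiv> \<lambda>a. axis a 1"

text \<open>Row elimination. All forms are treated at once, because a swap of two columns is absorbed by
  composing the form with the corresponding transposition of the coordinates.\<close>
lemma alternating_multilinear_matrix:
  fixes M :: "real^'n::finite^'n"
  shows "\<forall>\<omega>. alternating_multilinear \<omega> \<longrightarrow> \<omega> (\<lambda>i. M $ i) = \<omega> std_frame * det M"
proof (induction M rule: induct_matrix_row_operations)
  case zero_row: (1 M i)
  show ?case
  proof (intro allI impI)
    fix \<omega> :: "('n \<Rightarrow> real^'n) \<Rightarrow> real" assume \<omega>: "alternating_multilinear \<omega>"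
    have "M $ i = 0" using zero_row by (simp add: row_def vec_lambda_eta)
    then have "(\<lambda>i. M $ i)(i := 0) = (\<lambda>i. M $ i)" by auto
    then have "\<omega> (\<lambda>i. M $ i) = 0"
      using linear_0[OF alternating_multilinear_linear[OF \<omega>, of "\<lambda>i. M $ i" i]] by simp
    then show "\<omega> (\<lambda>i. M $ i) = \<omega> std_frame * det M" using det_zero_row(2)[OF zero_row] by simp
  qed
next
  case diagonal: (2 M)
  show ?case
  proof (intro allI impI)
    fix \<omega> :: "('n \<Rightarrow> real^'n) \<Rightarrow> real" assume \<omega>: "alternating_multilinear \<omega>"
    have *: "\<omega> (\<lambda>i. if i \<in> S then M $ i $ i *\<^sub>R axis i 1 else axis i 1) = (\<Prod>i\<in>S. M $ i $ i) * \<omega> std_frame" for S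
    proof (induction S rule: infinite_finite_induct)
      case (insert k S)
      let ?v = "\<lambda>i. if i \<in> S then M $ i $ i *\<^sub>R axis i 1 else axis i 1 :: real^'n"
      have "(\<lambda>i. if i \<in> insert k S then M $ i $ i *\<^sub>R axis i 1 else axis i 1) = ?v(k := M $ k $ k *\<^sub>R axis k 1)"
        by auto
      moreover have "?v(k := axis k 1) = ?v" using insert by auto
      ultimately show ?case
        using linear_cmul[OF alternating_multilinear_linear[OF \<omega>, of ?v k], of "M $ k $ k" "axis k 1"] insert
        by simp
    qed auto
    have "(\<lambda>i. M $ i) = (\<lambda>i. if i \<in> UNIV then M $ i $ i *\<^sub>R axis i 1 else axis i 1)"
    proof (intro ext, subst vec_eq_iff, intro allI)
      fix i j
      show "M $ i $ j = (if i \<in> UNIV then M $ i $ i *\<^sub>R axis i 1 else axis i 1) $ j"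
        by (cases "j = i") (simp_all add: axis_def diagonal)
    qed
    then have "\<omega> (\<lambda>i. M $ i) = (\<Prod>i\<in>UNIV. M $ i $ i) * \<omega> std_frame" unfolding *[symmetric] by (rule arg_cong)
    then show "\<omega> (\<lambda>i. M $ i) = \<omega> std_frame * det M" using det_diagonal[of M] diagonal by simp
  qed
next
  case swap_cols: (3 M m n)
  show ?case
  proof (intro allI impI)
    fix \<omega> :: "('n \<Rightarrow> real^'n) \<Rightarrow> real" assume \<omega>: "alternating_multilinear \<omega>"
    let ?\<tau> = "Transposition.transpose m n"
    define L :: "real^'n \<Rightarrow> real^'n" where "L = (\<lambda>x. \<chi> j. x $ ?\<tau> j)"
    have L: "linear L" by (rule linearI) (simp_all add: L_def vec_eq_iff)
    have "?\<tau> j = i \<longleftrightarrow> j = ?\<tau> i" for i j by (metis transpose_involutory)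
    then have "L (axis i 1) = axis (?\<tau> i) 1" for i by (simp add: L_def vec_eq_iff axis_def)
    moreover have "?\<tau> m = n" "?\<tau> n = m" by simp_all
    moreover have "?\<tau> i = i" if "i \<noteq> m" "i \<noteq> n" for i using that by (rule transpose_apply_other)
    ultimately have "(\<lambda>i. L (axis i 1)) = std_frame(m := axis n 1, n := axis m 1)"
      using swap_cols(2) by (simp add: fun_eq_iff)
    then have E: "\<omega> (\<lambda>i. L (axis i 1)) = - \<omega> std_frame"
      using alternating_multilinear_swap[OF \<omega> swap_cols(2), of std_frame] by simp
    have M': "(\<lambda>i. (\<chi> i j. M $ i $ ?\<tau> j) $ i) = (\<lambda>i. L (M $ i))" by (simp add: L_def)
    have "det (\<chi> i j. M $ i $ ?\<tau> j) = - det M"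
      using det_permute_columns[OF permutes_swap_id[OF UNIV_I UNIV_I, of m n], of M] swap_cols(2) by (simp add: sign_swap_id)
    then show "\<omega> (\<lambda>i. (\<chi> i j. M $ i $ ?\<tau> j) $ i) = \<omega> std_frame * det (\<chi> i j. M $ i $ ?\<tau> j)"
      using swap_cols(1)[rule_format, OF alternating_multilinear_compose_linear[OF \<omega> L]]
      unfolding M' E by simp
  qed
next
  case row_op: (4 M m n c)
  show ?case
  proof (intro allI impI)
    fix \<omega> :: "('n \<Rightarrow> real^'n) \<Rightarrow> real" assume \<omega>: "alternating_multilinear \<omega>"
    let ?M' = "\<chi> i. if i = m then row m M + c *\<^sub>R row n M else row i M"
    let ?v = "\<lambda>i. M $ i"
    have M': "(\<lambda>i. ?M' $ i) = ?v(m := M $ m + c *\<^sub>R M $ n)"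
      by (auto simp: row_def vec_lambda_eta)
    have "\<omega> (?v(m := M $ n)) = 0"
      by (rule alternating_multilinear_repeat[OF \<omega> row_op(2)]) (use row_op(2) in simp)
    moreover have "?v(m := M $ m) = ?v" by auto
    ultimately have "\<omega> (?v(m := M $ m + c *\<^sub>R M $ n)) = \<omega> ?v"
      using linear_add[OF alternating_multilinear_linear[OF \<omega>, of ?v m], of "M $ m" "c *\<^sub>R M $ n"]
        linear_cmul[OF alternating_multilinear_linear[OF \<omega>, of ?v m], of c "M $ n"] by simp
    with arg_cong[OF M', of \<omega>] have "\<omega> (\<lambda>i. ?M' $ i) = \<omega> ?v" by (rule trans)
    moreover have "det ?M' = det M"
      by (rule det_row_operation[OF row_op(2), of M c, unfolded scalar_mult_eq_scaleR])
    ultimately show "\<omega> (\<lambda>i. ?M' $ i) = \<omega> std_frame * det ?M'" using row_op(1) \<omega> by simp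
  qed
qed

lemma alternating_multilinear_det:
  fixes \<omega> :: "('n::finite \<Rightarrow> real^'n) \<Rightarrow> real"
  assumes "alternating_multilinear \<omega>"
  shows "\<omega> v = \<omega> std_frame * det (\<chi> i. v i)"
proof -
  have "($) (\<chi> i. v i) = v" by (rule ext) simp
  with alternating_multilinear_matrix[rule_format, OF assms, of "\<chi> i. v i"] show ?thesis by (simp only:)
qed

text \<open>Forms of top degree make up a line.\<close>
lemma alternating_multilinear_proportional:
  fixes \<omega> \<eta> :: "('n::finite \<Rightarrow> real^'n) \<Rightarrow> real"
  assumes \<omega>: "alternating_multilinear \<omega>" and \<eta>: "alternating_multilinear \<eta>" and "\<omega> u \<noteq> 0"
  obtains c where "\<eta> = (\<lambda>v. c * \<omega> v)"
proof
  have nz: "\<omega> std_frame \<noteq> 0" by (metis alternating_multilinear_det[OF \<omega>] assms(3) mult_zero_left)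
  show "\<eta> = (\<lambda>v. \<eta> std_frame / \<omega> std_frame * \<omega> v)"
  proof
    fix v :: "'n \<Rightarrow> real^'n"
    have "\<eta> std_frame / \<omega> std_frame * (\<omega> std_frame * det (\<chi> i. v i)) = \<eta> std_frame * det (\<chi> i. v i)"
      using nz by simp
    then show "\<eta> v = \<eta> std_frame / \<omega> std_frame * \<omega> v"
      unfolding alternating_multilinear_det[OF \<omega>, of v] alternating_multilinear_det[OF \<eta>, of v] by (rule sym)
  qed
qed

section \<open>Differentials of maps in charts\<close>

definition coord_rep :: "('a, 'n::finite) chart \<Rightarrow> ('a, 'n) chart \<Rightarrow> ('a \<Rightarrow> 'a) \<Rightarrow> real^'n \<Rightarrow> real^'n" where
  "coord_rep c d \<phi> = snd d \<circ> \<phi> \<circ> chart_inv c"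

text \<open>Both \<open>change\<close> (for \<open>\<phi> = id\<close>) and \<open>push\<close> (for the charts chosen at the two points) are instances,
  so that one chain rule serves for changes of charts, differentials of maps and their mixtures.\<close>
definition differential :: "('a, 'n::finite) chart \<Rightarrow> ('a, 'n) chart \<Rightarrow> ('a \<Rightarrow> 'a) \<Rightarrow> 'a \<Rightarrow> real^'n \<Rightarrow> real^'n" where
  "differential c d \<phi> q = frechet_derivative (coord_rep c d \<phi>) (at (snd c q))"

lemma change_eq_differential: "change c d q = differential c d id q"
  by (simp add: change_def differential_def coord_rep_def)

lemma push_eq_differential: "push A \<phi> q = differential (chart_at A q) (chart_at A (\<phi> q)) \<phi> q"
  by (simp add: push_def differential_def coord_rep_def Let_def)

locale smooth_manifold =
  fixes A :: "('a::topological_space, 'n::finite) chart set"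
  assumes atlas: "smooth_atlas A"
begin

lemma is_chart: "c \<in> A \<Longrightarrow> is_chart c"
  using atlas by (simp add: smooth_atlas_def)

lemma chart_at: "chart_at A q \<in> A" "q \<in> fst (chart_at A q)"
proof -
  have "q \<in> (\<Union>c\<in>A. fst c)" using atlas by (simp add: smooth_atlas_def)
  then have "\<exists>c. c \<in> A \<and> q \<in> fst c" by blast
  from someI_ex[OF this] show "chart_at A q \<in> A" "q \<in> fst (chart_at A q)"
    by (simp_all add: chart_at_def)
qed

lemma chart_inv_chart: "c \<in> A \<Longrightarrow> q \<in> fst c \<Longrightarrow> chart_inv c (snd c q) = q"
  using is_chart by (fastforce simp: is_chart_def homeomorphism_def)

lemma open_chart_image:
  assumes "c \<in> A" "open U"
  shows "open (snd c ` (fst c \<inter> U))"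
proof -
  have h: "homeomorphism (fst c) (snd c ` fst c) (snd c) (chart_inv c)"
    and o: "open (fst c)" "open (snd c ` fst c)"
    using is_chart[OF assms(1)] by (simp_all add: is_chart_def)
  have "openin (top_of_set (snd c ` fst c)) (snd c ` (fst c \<inter> U))"
    by (rule homeomorphism_imp_open_map[OF h]) (simp add: openin_open_Int assms(2))
  then show ?thesis using o(2) openin_open_eq by blast
qed

lemma continuous_on_chart: "c \<in> A \<Longrightarrow> continuous_on (fst c) (snd c)"
  using is_chart by (auto simp: is_chart_def homeomorphism_def)

lemma smooth_map_on_preimage_open:
  assumes "smooth_map_on A W \<phi>" "open W" "open T"
  shows "open (W \<inter> \<phi> -` T)"
  using assms by (simp add: smooth_map_on_def continuous_on_open_vimage Int_commute)

lemma smooth_map_on_subset: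
  assumes "smooth_map_on A T \<phi>" "S \<subseteq> T"
  shows "smooth_map_on A S \<phi>"
  unfolding smooth_map_on_def
proof (intro conjI ballI)
  show "continuous_on S \<phi>"
    using assms continuous_on_subset by (auto simp: smooth_map_on_def)
  fix c d assume "c \<in> A" "d \<in> A"
  then have "smooth_on (snd c ` (fst c \<inter> T \<inter> \<phi> -` fst d)) (snd d \<circ> \<phi> \<circ> chart_inv c)"
    using assms(1) by (simp add: smooth_map_on_def)
  then show "smooth_on (snd c ` (fst c \<inter> S \<inter> \<phi> -` fst d)) (snd d \<circ> \<phi> \<circ> chart_inv c)"
    by (rule smooth_on_subset) (use assms(2) in blast)
qed

lemma open_coord_domain:
  assumes "smooth_map_on A W \<phi>" "open W" "c \<in> A" "d \<in> A"
  shows "open (snd c ` (fst c \<inter> W \<inter> \<phi> -` fst d))"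
proof -
  have "open (fst d)" using is_chart[OF assms(4)] by (simp add: is_chart_def)
  from open_chart_image[OF assms(3) smooth_map_on_preimage_open[OF assms(1,2) this]]
  show ?thesis by (simp add: Int_assoc)
qed

lemma smooth_coord_rep:
  assumes "smooth_map_on A W \<phi>" "c \<in> A" "d \<in> A"
  shows "smooth_on (snd c ` (fst c \<inter> W \<inter> \<phi> -` fst d)) (coord_rep c d \<phi>)"
  using assms by (simp add: smooth_map_on_def coord_rep_def)

lemma smooth_map_id: "smooth_map_on A UNIV id"
  using atlas by (simp add: smooth_map_on_def smooth_atlas_def)

lemma coord_rep_chart: "c \<in> A \<Longrightarrow> q \<in> fst c \<Longrightarrow> coord_rep c d \<phi> (snd c q) = snd d (\<phi> q)"
  by (simp add: coord_rep_def chart_inv_chart)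

lemma has_derivative_coord_rep:
  assumes "smooth_map_on A W \<phi>" "c \<in> A" "d \<in> A" "q \<in> W" "q \<in> fst c" "\<phi> q \<in> fst d"
  shows "(coord_rep c d \<phi> has_derivative differential c d \<phi> q) (at (snd c q))"
  unfolding differential_def
  by (rule smooth_on_has_derivative[OF smooth_coord_rep[OF assms(1-3)]]) (use assms in auto)

lemma linear_differential:
  assumes "smooth_map_on A W \<phi>" "c \<in> A" "d \<in> A" "q \<in> W" "q \<in> fst c" "\<phi> q \<in> fst d"
  shows "linear (differential c d \<phi> q)"
  by (rule has_derivative_linear[OF has_derivative_coord_rep[OF assms]])

lemma differential_compose:
  assumes \<phi>: "smooth_map_on A W \<phi>" "open W" and \<psi>: "smooth_map_on A W' \<psi>"
    and q: "q \<in> W" "\<phi> q \<in> W'"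
    and charts: "c \<in> A" "d \<in> A" "e \<in> A" "q \<in> fst c" "\<phi> q \<in> fst d" "\<psi> (\<phi> q) \<in> fst e"
  shows "differential d e \<psi> (\<phi> q) (differential c d \<phi> q v) = differential c e (\<psi> \<circ> \<phi>) q v"
proof -
  have "(coord_rep d e \<psi> has_derivative differential d e \<psi> (\<phi> q)) (at (coord_rep c d \<phi> (snd c q)))"
    using has_derivative_coord_rep[OF \<psi> charts(2,3) q(2) charts(5,6)]
    by (simp add: coord_rep_chart charts)
  from has_derivative_compose[OF has_derivative_coord_rep[OF \<phi>(1) charts(1,2) q(1) charts(4,5)] this]
  have "((\<lambda>x. coord_rep d e \<psi> (coord_rep c d \<phi> x)) has_derivative
      (\<lambda>v. differential d e \<psi> (\<phi> q) (differential c d \<phi> q v))) (at (snd c q))" .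
  then have "(coord_rep c e (\<psi> \<circ> \<phi>) has_derivative
      (\<lambda>v. differential d e \<psi> (\<phi> q) (differential c d \<phi> q v))) (at (snd c q))"
    by (rule has_derivative_transform_within_open[OF _ open_coord_domain[OF \<phi> charts(1,2)]])
      (use q charts in \<open>auto simp: coord_rep_chart\<close>)
  then show ?thesis unfolding differential_def by (rule frechet_derivative_eqI[symmetric])
qed

lemma differential_id:
  assumes "c \<in> A" "q \<in> fst c"
  shows "differential c c id q v = v"
proof -
  have "((\<lambda>x. x) has_derivative (\<lambda>v. v)) (at (snd c q))" by simp
  then have "(coord_rep c c id has_derivative (\<lambda>v. v)) (at (snd c q))"
    by (rule has_derivative_transform_within_open[OF _ open_chart_image[OF assms(1) open_UNIV]])
      (use assms in \<open>auto simp: coord_rep_chart\<close>)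
  then show ?thesis unfolding differential_def by (rule frechet_derivative_eqI)
qed

lemma differential_cong:
  assumes "open W" "\<And>p. p \<in> W \<Longrightarrow> \<phi> p = \<psi> p" "c \<in> A" "q \<in> W" "q \<in> fst c"
  shows "differential c d \<phi> q = differential c d \<psi> q"
  unfolding differential_def
proof (rule frechet_derivative_cong_open[OF open_chart_image[OF assms(3,1)]])
  show "snd c q \<in> snd c ` (fst c \<inter> W)" using assms by blast
qed (use assms in \<open>auto simp: coord_rep_chart\<close>)

lemma push_compose:
  assumes \<phi>: "smooth_map_on A W \<phi>" "open W" and \<psi>: "smooth_map_on A W' \<psi>"
    and q: "q \<in> W" "\<phi> q \<in> W'"
  shows "push A \<psi> (\<phi> q) (push A \<phi> q v) = push A (\<psi> \<circ> \<phi>) q v"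
  using differential_compose[OF assms chart_at(1) chart_at(1) chart_at(1) chart_at(2) chart_at(2) chart_at(2)]
  by (simp add: push_eq_differential)

text \<open>Stated for maps that are the identity only on an open set, because a composition of a local
  diffeomorphism with its local inverse is of this kind.\<close>
lemma push_eq_id:
  assumes "open W" "\<And>p. p \<in> W \<Longrightarrow> \<phi> p = p" "q \<in> W"
  shows "push A \<phi> q v = v"
proof -
  have "push A \<phi> q = differential (chart_at A q) (chart_at A q) id q"
    using differential_cong[OF assms(1) _ chart_at(1) assms(3) chart_at(2), of \<phi> id] assms(2,3)
    by (simp add: push_eq_differential)
  then show ?thesis by (simp add: differential_id chart_at)
qed

lemma linear_push: "smooth_map_on A W \<phi> \<Longrightarrow> q \<in> W \<Longrightarrow> linear (push A \<phi> q)"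
  unfolding push_eq_differential by (rule linear_differential) (simp_all add: chart_at)

section \<open>Brackets on the manifold\<close>

lemma field_rep_chart:
  "c \<in> A \<Longrightarrow> q \<in> fst c \<Longrightarrow> field_rep A c X (snd c q) = differential (chart_at A q) c id q (X q)"
  by (simp add: field_rep_def chart_inv_chart change_eq_differential Let_def)

lemma field_rep_chart_at: "field_rep A (chart_at A q) X (snd (chart_at A q) q) = X q"
  by (simp add: field_rep_chart chart_at differential_id)

text \<open>Related fields stay related by the coordinate representation of \<open>\<phi>\<close> in any two charts, not only in
  the ones chosen at the points; both sides are the differential of \<open>\<phi>\<close> in mixed charts applied to
  \<open>X q\<close>.\<close>
lemma field_rep_related:
  assumes \<phi>: "smooth_map_on A W \<phi>" "open W" and q: "q \<in> W" and rel: "X' (\<phi> q) = push A \<phi> q (X q)"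
    and charts: "c \<in> A" "d \<in> A" "q \<in> fst c" "\<phi> q \<in> fst d"
  shows "field_rep A d X' (snd d (\<phi> q)) = differential c d \<phi> q (field_rep A c X (snd c q))"
proof -
  have "field_rep A d X' (snd d (\<phi> q)) = differential (chart_at A q) d (id \<circ> \<phi>) q (X q)"
    unfolding field_rep_chart[OF charts(2,4)] rel push_eq_differential
    by (rule differential_compose[OF \<phi> smooth_map_id q]) (simp_all add: chart_at charts)
  also have "\<dots> = differential (chart_at A q) d (\<phi> \<circ> id) q (X q)" by simp
  also have "\<dots> = differential c d \<phi> (id q) (differential (chart_at A q) c id q (X q))"
    by (rule differential_compose[OF smooth_map_id open_UNIV \<phi>(1), symmetric])
      (simp_all add: chart_at charts q)
  finally show ?thesis by (simp add: field_rep_chart[OF charts(1,3)])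
qed

lemma smooth_field_rep:
  "smooth_field_on A U X \<Longrightarrow> c \<in> A \<Longrightarrow> smooth_on (snd c ` (fst c \<inter> U)) (field_rep A c X)"
  by (simp add: smooth_field_on_def)

lemma smooth_field_on_subset:
  assumes "smooth_field_on A U X" "U' \<subseteq> U"
  shows "smooth_field_on A U' X"
  unfolding smooth_field_on_def
proof
  fix c assume "c \<in> A"
  show "smooth_on (snd c ` (fst c \<inter> U')) (field_rep A c X)"
    by (rule smooth_on_subset[OF smooth_field_rep[OF assms(1) \<open>c \<in> A\<close>]]) (use assms(2) in blast)
qed

text \<open>\<open>bracket\<close> uses a chart that varies with the point. Iterated brackets have to be differentiated, for
  which the same formula is needed in one fixed chart.\<close>
definition coord_bracket :: "('a, 'n) chart \<Rightarrow> ('a \<Rightarrow> real^'n) \<Rightarrow> ('a \<Rightarrow> real^'n) \<Rightarrow> real^'n \<Rightarrow> real^'n" where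
  "coord_bracket c X Y x = frechet_derivative (field_rep A c Y) (at x) (field_rep A c X x)
     - frechet_derivative (field_rep A c X) (at x) (field_rep A c Y x)"

lemma bracket_eq_coord_bracket: "bracket A X Y q = coord_bracket (chart_at A q) X Y (snd (chart_at A q) q)"
  by (simp add: bracket_def coord_bracket_def field_rep_chart_at Let_def)

lemma coord_bracket_related:
  assumes \<phi>: "smooth_map_on A W \<phi>" "open W" and q: "q \<in> W"
    and X: "smooth_field_on A W X" and Y: "smooth_field_on A W Y"
    and X': "smooth_field_on A W' X'" and Y': "smooth_field_on A W' Y'" and W': "\<phi> q \<in> W'"
    and relX: "\<And>p. p \<in> W \<Longrightarrow> X' (\<phi> p) = push A \<phi> p (X p)"
    and relY: "\<And>p. p \<in> W \<Longrightarrow> Y' (\<phi> p) = push A \<phi> p (Y p)"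
    and charts: "c \<in> A" "d \<in> A" "q \<in> fst c" "\<phi> q \<in> fst d"
  shows "coord_bracket d X' Y' (snd d (\<phi> q)) = differential c d \<phi> q (coord_bracket c X Y (snd c q))"
proof -
  let ?S = "snd c ` (fst c \<inter> W \<inter> \<phi> -` fst d)" and ?F = "coord_rep c d \<phi>"
  have F: "?F (snd c q) = snd d (\<phi> q)" by (simp add: coord_rep_chart charts)
  have d: "field_rep A c Z differentiable (at (snd c q))" if "smooth_field_on A W Z" for Z
    by (rule smooth_on_differentiable[OF smooth_field_rep[OF that charts(1)]]) (use q charts in blast)
  have d': "field_rep A d Z differentiable (at (?F (snd c q)))" if "smooth_field_on A W' Z" for Z
    unfolding F
    by (rule smooth_on_differentiable[OF smooth_field_rep[OF that charts(2)]]) (use W' charts in blast)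
  have rel: "field_rep A d Z' (?F y) = frechet_derivative ?F (at y) (field_rep A c Z y)"
    if "\<And>p. p \<in> W \<Longrightarrow> Z' (\<phi> p) = push A \<phi> p (Z p)" "y \<in> ?S" for y Z Z'
  proof -
    obtain p where p: "y = snd c p" "p \<in> fst c" "p \<in> W" "\<phi> p \<in> fst d" using \<open>y \<in> ?S\<close> by auto
    show ?thesis
      using field_rep_related[where X' = Z' and X = Z, OF \<phi> p(3) that(1)[OF p(3)] charts(1,2) p(2,4)] p
      by (simp add: coord_rep_chart charts differential_def)
  qed
  have "snd c q \<in> ?S" using q charts by blast
  from bracket_of_related_fields[OF open_coord_domain[OF \<phi> charts(1,2)] this
      smooth_coord_rep[OF \<phi>(1) charts(1,2)] d[OF X] d'[OF X'] d[OF Y] d'[OF Y'] rel[OF relX] rel[OF relY]]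
  show ?thesis by (simp add: coord_bracket_def F differential_def)
qed

lemma bracket_related:
  assumes "smooth_map_on A W \<phi>" "open W" "q \<in> W"
    and "smooth_field_on A W X" "smooth_field_on A W Y"
    and "smooth_field_on A W' X'" "smooth_field_on A W' Y'" "\<phi> q \<in> W'"
    and "\<And>p. p \<in> W \<Longrightarrow> X' (\<phi> p) = push A \<phi> p (X p)"
    and "\<And>p. p \<in> W \<Longrightarrow> Y' (\<phi> p) = push A \<phi> p (Y p)"
  shows "bracket A X' Y' (\<phi> q) = push A \<phi> q (bracket A X Y q)"
  using coord_bracket_related[OF assms chart_at(1) chart_at(1) chart_at(2) chart_at(2)]
  by (simp add: bracket_eq_coord_bracket push_eq_differential)

text \<open>Independence of the chart: a field is related to itself by the identity map, whose coordinate
  representation is the transition map between the two charts.\<close>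
lemma field_rep_bracket:
  assumes U: "open U" "q \<in> U" and X: "smooth_field_on A U X" and Y: "smooth_field_on A U Y"
    and c: "c \<in> A" "q \<in> fst c"
  shows "field_rep A c (bracket A X Y) (snd c q) = coord_bracket c X Y (snd c q)"
proof -
  have id: "smooth_map_on A U id"
    using smooth_map_id by (auto simp: smooth_map_on_def intro: smooth_on_subset)
  have rel: "Z (id p) = push A id p (Z p)" for Z :: "'a \<Rightarrow> real^'n" and p
    by (simp add: push_eq_id[OF open_UNIV])
  have "id q \<in> U" "id q \<in> fst c" using U c by auto
  from coord_bracket_related[OF id U X Y X Y this(1) rel rel chart_at(1) c(1) chart_at(2) this(2)]
  show ?thesis by (simp add: field_rep_chart c bracket_eq_coord_bracket id_def)
qed

lemma smooth_field_bracket: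
  assumes U: "open U" and X: "smooth_field_on A U X" and Y: "smooth_field_on A U Y"
  shows "smooth_field_on A U (bracket A X Y)"
  unfolding smooth_field_on_def
proof
  fix c assume c: "c \<in> A"
  let ?S = "snd c ` (fst c \<inter> U)"
  have S: "open ?S" by (rule open_chart_image[OF c U])
  have "smooth_on ?S (coord_bracket c X Y)"
    unfolding coord_bracket_def
    by (rule smooth_on_diff[OF S smooth_on_apply_derivative[OF S] smooth_on_apply_derivative[OF S]])
      (simp_all add: smooth_field_rep c X Y)
  then show "smooth_on ?S (field_rep A c (bracket A X Y))"
    by (rule smooth_on_cong[OF S, rotated]) (use field_rep_bracket[OF U _ X Y c] in auto)
qed

lemma smooth_field_nested_bracket:
  assumes "open U" "Vs \<noteq> []" "\<forall>X\<in>set Vs. smooth_field_on A U X"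
  shows "smooth_field_on A U (nested_bracket A Vs)"
  using assms(2,3)
proof (induction Vs rule: induct_list012)
  case (3 X Y Xs)
  then show ?case using smooth_field_bracket[OF assms(1)] by simp
qed simp_all

lemma nested_bracket_related:
  assumes \<phi>: "smooth_map_on A W \<phi>" and W: "open W" "open W'" "\<phi> ` W \<subseteq> W'"
  shows "Vs \<noteq> [] \<Longrightarrow> \<forall>X\<in>set Vs. smooth_field_on A W X \<and> smooth_field_on A W' (F X) \<and>
      (\<forall>p\<in>W. F X (\<phi> p) = push A \<phi> p (X p)) \<Longrightarrow>
    q \<in> W \<Longrightarrow> nested_bracket A (map F Vs) (\<phi> q) = push A \<phi> q (nested_bracket A Vs q)"
proof (induction Vs arbitrary: q rule: induct_list012)
  case (3 X Y Xs)
  have IH: "nested_bracket A (F Y # map F Xs) (\<phi> p) = push A \<phi> p (nested_bracket A (Y # Xs) p)"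
    if "p \<in> W" for p using "3.IH"(2)[OF _ _ that] "3.prems"(2) by simp
  have "smooth_field_on A W (nested_bracket A (Y # Xs))"
    by (rule smooth_field_nested_bracket[OF W(1)]) (use "3.prems"(2) in auto)
  moreover have "smooth_field_on A W' (nested_bracket A (F Y # map F Xs))"
    by (rule smooth_field_nested_bracket[OF W(2)]) (use "3.prems"(2) in auto)
  ultimately show ?case
    using bracket_related[OF \<phi> W(1) \<open>q \<in> W\<close>, of X _ W' "F X" "nested_bracket A (F Y # map F Xs)"]
      IH "3.prems" W(3) by auto
qed simp_all

section \<open>Pushing vector fields forward\<close>

text \<open>The two inverse diffeomorphisms enter symmetrically, so that each inclusion proved for
  \<open>\<phi>\<close> also holds for its inverse \<open>\<psi>\<close>; this turns inclusions into equalities.\<close>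
definition diffeo_pair :: "'a set \<Rightarrow> 'a set \<Rightarrow> ('a \<Rightarrow> 'a) \<Rightarrow> ('a \<Rightarrow> 'a) \<Rightarrow> bool" where
  "diffeo_pair V V' \<phi> \<psi> \<longleftrightarrow> open V \<and> open V' \<and> \<phi> ` V \<subseteq> V' \<and> \<psi> ` V' \<subseteq> V \<and>
     (\<forall>p\<in>V. \<psi> (\<phi> p) = p) \<and> (\<forall>p\<in>V'. \<phi> (\<psi> p) = p) \<and>
     smooth_map_on A V \<phi> \<and> smooth_map_on A V' \<psi>"

lemma diffeo_pair_sym: "diffeo_pair V V' \<phi> \<psi> \<Longrightarrow> diffeo_pair V' V \<psi> \<phi>"
  unfolding diffeo_pair_def by blast

lemma diffeo_pairD:
  assumes "diffeo_pair V V' \<phi> \<psi>"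
  shows "open V" "open V'" "smooth_map_on A V \<phi>" "smooth_map_on A V' \<psi>"
    "p \<in> V \<Longrightarrow> \<phi> p \<in> V'" "p' \<in> V' \<Longrightarrow> \<psi> p' \<in> V"
    "p \<in> V \<Longrightarrow> \<psi> (\<phi> p) = p" "p' \<in> V' \<Longrightarrow> \<phi> (\<psi> p') = p'"
  using assms unfolding diffeo_pair_def by blast+

lemma push_inverse:
  assumes "diffeo_pair V V' \<phi> \<psi>" "q \<in> V"
  shows "push A \<psi> (\<phi> q) (push A \<phi> q v) = v"
  using push_compose[OF diffeo_pairD(3,1,4)[OF assms(1)] assms(2) diffeo_pairD(5)[OF assms]]
    push_eq_id[OF diffeo_pairD(1)[OF assms(1)], of "\<psi> \<circ> \<phi>" q] assms(2) diffeo_pairD(7)[OF assms(1)]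
  by simp

lemma push_inverse':
  assumes "diffeo_pair V V' \<phi> \<psi>" "q \<in> V"
  shows "push A \<phi> q (push A \<psi> (\<phi> q) v) = v"
  using push_inverse[OF diffeo_pair_sym[OF assms(1)] diffeo_pairD(5)[OF assms]]
    diffeo_pairD(7)[OF assms] by simp

definition push_field :: "('a \<Rightarrow> 'a) \<Rightarrow> ('a \<Rightarrow> 'a) \<Rightarrow> ('a \<Rightarrow> real^'n) \<Rightarrow> 'a \<Rightarrow> real^'n" where
  "push_field \<phi> \<psi> X p = push A \<phi> (\<psi> p) (X (\<psi> p))"

lemma push_field_related:
  "diffeo_pair V V' \<phi> \<psi> \<Longrightarrow> p \<in> V \<Longrightarrow> push_field \<phi> \<psi> X (\<phi> p) = push A \<phi> p (X p)"
  by (simp add: push_field_def diffeo_pairD)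

lemma diffeo_pair_image:
  assumes "diffeo_pair V V' \<phi> \<psi>" "U \<subseteq> V"
  shows "\<phi> ` U = V' \<inter> \<psi> -` U"
proof
  show "\<phi> ` U \<subseteq> V' \<inter> \<psi> -` U"
    using assms(2) diffeo_pairD[OF assms(1)] by force
  show "V' \<inter> \<psi> -` U \<subseteq> \<phi> ` U"
    using diffeo_pairD(8)[OF assms(1)] by (metis IntE image_eqI subsetI vimageE)
qed

lemma open_diffeo_pair_image:
  assumes "diffeo_pair V V' \<phi> \<psi>" "U \<subseteq> V" "open U"
  shows "open (\<phi> ` U)"
  using smooth_map_on_preimage_open[OF diffeo_pairD(4,2)[OF assms(1)] assms(3)]
  by (simp add: diffeo_pair_image[OF assms(1,2)])

text \<open>Near a point the representation of the pushed field is \<open>x \<mapsto> D\<phi>(x) X(x)\<close> composed with the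
  representation of \<open>\<psi>\<close>.\<close>
lemma smooth_push_field:
  assumes pair: "diffeo_pair V V' \<phi> \<psi>" and U: "U \<subseteq> V" "open U" and X: "smooth_field_on A U X"
  shows "smooth_field_on A (\<phi> ` U) (push_field \<phi> \<psi> X)"
  unfolding smooth_field_on_def
proof (intro ballI smooth_on_locally)
  fix d y assume d: "d \<in> A" and "y \<in> snd d ` (fst d \<inter> \<phi> ` U)"
  then obtain p where p: "p \<in> U" "\<phi> p \<in> fst d" "y = snd d (\<phi> p)" by auto
  note \<phi> = diffeo_pairD(3,1)[OF pair] and \<psi> = diffeo_pairD(4,2)[OF pair]
  define c where "c = chart_at A p"
  have c: "c \<in> A" "p \<in> fst c" by (simp_all add: c_def chart_at)
  note \<phi>U = smooth_map_on_subset[OF \<phi>(1) U(1)] U(2)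
  let ?S = "snd c ` (fst c \<inter> U \<inter> \<phi> -` fst d)"
  let ?N = "snd d ` (fst d \<inter> \<phi> ` U \<inter> \<psi> -` fst c)"
  let ?G = "\<lambda>x. frechet_derivative (coord_rep c d \<phi>) (at x) (field_rep A c X x)"
  have "smooth_map_on A (\<phi> ` U) \<psi>"
    by (rule smooth_map_on_subset[OF \<psi>(1)]) (simp add: diffeo_pair_image[OF pair U(1)])
  note \<psi>U = this open_diffeo_pair_image[OF pair U]
  \<comment> \<open>On \<open>?N\<close> the inverse \<open>\<psi>\<close> leads back into the domain of the single chart \<open>c\<close>.\<close>
  have N: "open ?N" by (rule open_coord_domain[OF \<psi>U d c(1)])
  have "smooth_on ?S (field_rep A c X)"
    by (rule smooth_on_subset[OF smooth_field_rep[OF X c(1)]]) blast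
  then have G: "smooth_on ?S ?G"
    by (rule smooth_on_apply_derivative[OF open_coord_domain[OF \<phi>U c(1) d] smooth_coord_rep[OF \<phi>U(1) c(1) d]])
  have in_N: "\<exists>r. r \<in> U \<and> r \<in> fst c \<and> \<phi> r \<in> fst d \<and> z = snd d (\<phi> r)" if "z \<in> ?N" for z
    using that U(1) diffeo_pairD(7)[OF pair] by (auto simp: subset_iff)
  have \<psi>_rep: "coord_rep d c \<psi> (snd d (\<phi> r)) = snd c r" if "r \<in> U" "\<phi> r \<in> fst d" for r
    using that U(1) diffeo_pairD(7)[OF pair, of r] by (auto simp: coord_rep_chart[OF d])
  have "smooth_on ?N (\<lambda>z. ?G (coord_rep d c \<psi> z))"
  proof (rule smooth_on_compose[OF N _ G smooth_coord_rep[OF \<psi>U(1) d c(1)]])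
    show "coord_rep d c \<psi> ` ?N \<subseteq> ?S"
    proof
      fix x assume "x \<in> coord_rep d c \<psi> ` ?N"
      then obtain z where "z \<in> ?N" "x = coord_rep d c \<psi> z" by blast
      moreover from in_N[OF this(1)] obtain r
        where "r \<in> U" "r \<in> fst c" "\<phi> r \<in> fst d" "z = snd d (\<phi> r)" by blast
      ultimately show "x \<in> ?S" using \<psi>_rep by simp
    qed
  qed
  then have "smooth_on ?N (field_rep A d (push_field \<phi> \<psi> X))"
  proof (rule smooth_on_cong[OF N, rotated])
    fix z assume "z \<in> ?N"
    from in_N[OF this] obtain r where r: "r \<in> U" "r \<in> fst c" "\<phi> r \<in> fst d" "z = snd d (\<phi> r)" by blast
    have "r \<in> V" using r U by blast
    from field_rep_related[where X' = "push_field \<phi> \<psi> X" and X = X,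
        OF \<phi> this push_field_related[OF pair this] c(1) d r(2,3)]
    show "?G (coord_rep d c \<psi> z) = field_rep A d (push_field \<phi> \<psi> X) z"
      by (simp add: r(4) \<psi>_rep[OF r(1,3)] differential_def)
  qed
  moreover have "y \<in> ?N" using p c U(1) diffeo_pairD(7)[OF pair, of p] by auto
  ultimately show "\<exists>N. open N \<and> y \<in> N \<and> smooth_on N (field_rep A d (push_field \<phi> \<psi> X))"
    using N by blast
qed

section \<open>Invariance of the flag and of the quotient norms\<close>

definition isometry_pair ::
  "('a \<Rightarrow> (real^'n) set) \<Rightarrow> ('a \<Rightarrow> real^'n \<Rightarrow> real^'n \<Rightarrow> real) \<Rightarrow> 'a set \<Rightarrow> 'a set \<Rightarrow> ('a \<Rightarrow> 'a) \<Rightarrow> ('a \<Rightarrow> 'a) \<Rightarrow> bool" where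
  "isometry_pair D g V V' \<phi> \<psi> \<longleftrightarrow> diffeo_pair V V' \<phi> \<psi> \<and> isometric_on A D g V \<phi>"

text \<open>The inverse of a local isometry is one, which is why \<open>isometry_pair\<close> asks for it only in one
  direction.\<close>
lemma isometry_pair_sym:
  assumes "isometry_pair D g V V' \<phi> \<psi>"
  shows "isometry_pair D g V' V \<psi> \<phi>"
proof -
  have pair: "diffeo_pair V V' \<phi> \<psi>" and iso: "isometric_on A D g V \<phi>"
    using assms by (simp_all add: isometry_pair_def)
  have "isometric_on A D g V' \<psi>"
    unfolding isometric_on_def
  proof (intro ballI conjI)
    fix q' assume q': "q' \<in> V'"
    define q where "q = \<psi> q'"
    have q: "q \<in> V" "\<phi> q = q'" using diffeo_pairD(6,8)[OF pair q'] by (simp_all add: q_def)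
    have D: "D q' = push A \<phi> q ` D q" using iso q by (auto simp: isometric_on_def)
    have inv: "push A \<psi> q' (push A \<phi> q v) = v" for v using push_inverse[OF pair q(1)] q(2) by simp
    show "push A \<psi> q' ` D q' = D (\<psi> q')" by (simp add: D image_image inv flip: q_def)
    fix X Y assume "X \<in> D q'" "Y \<in> D q'"
    then obtain X' Y' where "X' \<in> D q" "Y' \<in> D q" "X = push A \<phi> q X'" "Y = push A \<phi> q Y'"
      unfolding D by blast
    then show "g (\<psi> q') (push A \<psi> q' X) (push A \<psi> q' Y) = g q' X Y"
      using iso q by (auto simp: inv isometric_on_def simp flip: q_def)
  qed
  then show ?thesis using diffeo_pair_sym[OF pair] by (simp add: isometry_pair_def)
qed

text \<open>The sections live on an arbitrary neighbourhood \<open>U\<close> of \<open>q\<close>; cutting it down to \<open>U \<inter> V\<close> does not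
  change the values of brackets at \<open>q\<close>.\<close>
lemma push_sections:
  assumes iso: "isometry_pair D g V V' \<phi> \<psi>" and U: "open U" "q \<in> U" and q: "q \<in> V"
  obtains U' where "open U'" "\<phi> q \<in> U'"
    "\<And>X. X \<in> sections A D U \<Longrightarrow> push_field \<phi> \<psi> X \<in> sections A D U'"
    "\<And>Vs. Vs \<noteq> [] \<Longrightarrow> set Vs \<subseteq> sections A D U \<Longrightarrow>
       nested_bracket A (map (push_field \<phi> \<psi>) Vs) (\<phi> q) = push A \<phi> q (nested_bracket A Vs q)"
proof -
  have pair: "diffeo_pair V V' \<phi> \<psi>" using iso by (simp add: isometry_pair_def)
  let ?U = "U \<inter> V"
  have sub: "?U \<subseteq> V" and opn: "open ?U" using U diffeo_pairD(1)[OF pair] by auto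
  have smooth: "smooth_field_on A ?U X \<and> smooth_field_on A (\<phi> ` ?U) (push_field \<phi> \<psi> X)"
    if "X \<in> sections A D U" for X
  proof -
    have "smooth_field_on A ?U X"
      by (rule smooth_field_on_subset[of U]) (use that in \<open>auto simp: sections_def\<close>)
    then show ?thesis using smooth_push_field[OF pair sub opn] by simp
  qed
  show ?thesis
  proof (rule that[of "\<phi> ` ?U"])
    show "open (\<phi> ` ?U)" by (rule open_diffeo_pair_image[OF pair sub opn])
    show "\<phi> q \<in> \<phi> ` ?U" using q U by blast
    show "push_field \<phi> \<psi> X \<in> sections A D (\<phi> ` ?U)" if X: "X \<in> sections A D U" for X
      unfolding sections_def
    proof (intro CollectI conjI ballI)
      show "smooth_field_on A (\<phi> ` ?U) (push_field \<phi> \<psi> X)" using smooth[OF X] by simp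
      fix p' assume "p' \<in> \<phi> ` ?U"
      then obtain p where p: "p \<in> U" "p \<in> V" "p' = \<phi> p" by auto
      have "X p \<in> D p" using X p by (simp add: sections_def)
      then show "push_field \<phi> \<psi> X p' \<in> D p'"
        using iso p by (auto simp: push_field_related[OF pair] isometry_pair_def isometric_on_def)
    qed
    from nested_bracket_related[OF smooth_map_on_subset[OF diffeo_pairD(3)[OF pair] sub] opn open_diffeo_pair_image[OF pair sub opn] subset_refl]
    show "nested_bracket A (map (push_field \<phi> \<psi>) Vs) (\<phi> q) = push A \<phi> q (nested_bracket A Vs q)"
      if "Vs \<noteq> []" "set Vs \<subseteq> sections A D U" for Vs
      using that smooth q U push_field_related[OF pair] by blast
  qed
qed

lemma linear_push_pair: "isometry_pair D g V V' \<phi> \<psi> \<Longrightarrow> q \<in> V \<Longrightarrow> linear (push A \<phi> q)"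
  by (rule linear_push[OF diffeo_pairD(3)[of V V' \<phi> \<psi>]]) (simp_all add: isometry_pair_def)

lemma push_flag_subset:
  assumes iso: "isometry_pair D g V V' \<phi> \<psi>" and q: "q \<in> V"
  shows "push A \<phi> q ` flag A D i q \<subseteq> flag A D i (\<phi> q)"
  unfolding flag_def linear_span_image[OF linear_push_pair[OF assms], symmetric]
proof (rule span_mono, rule subsetI)
  fix y assume "y \<in> push A \<phi> q ` {nested_bracket A Vs q |Vs U. open U \<and> q \<in> U \<and>
     set Vs \<subseteq> sections A D U \<and> Vs \<noteq> [] \<and> length Vs \<le> i}"
  then obtain Vs U where U: "open U" "q \<in> U" and Vs: "set Vs \<subseteq> sections A D U" "Vs \<noteq> []" "length Vs \<le> i"
    and y: "y = push A \<phi> q (nested_bracket A Vs q)" by blast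
  obtain U' where U': "open U'" "\<phi> q \<in> U'"
    "\<And>X. X \<in> sections A D U \<Longrightarrow> push_field \<phi> \<psi> X \<in> sections A D U'"
    "\<And>Vs. Vs \<noteq> [] \<Longrightarrow> set Vs \<subseteq> sections A D U \<Longrightarrow>
       nested_bracket A (map (push_field \<phi> \<psi>) Vs) (\<phi> q) = push A \<phi> q (nested_bracket A Vs q)"
    using push_sections[OF iso U q] by blast
  have "y = nested_bracket A (map (push_field \<phi> \<psi>) Vs) (\<phi> q)" using y U'(4) Vs by simp
  moreover have "set (map (push_field \<phi> \<psi>) Vs) \<subseteq> sections A D U'" using U'(3) Vs(1) by auto
  moreover have "map (push_field \<phi> \<psi>) Vs \<noteq> []" "length (map (push_field \<phi> \<psi>) Vs) \<le> i" using Vs by simp_all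
  ultimately show "y \<in> {nested_bracket A Vs (\<phi> q) |Vs U. open U \<and> \<phi> q \<in> U \<and>
     set Vs \<subseteq> sections A D U \<and> Vs \<noteq> [] \<and> length Vs \<le> i}" using U'(1,2) by blast
qed

text \<open>The reverse implication is the inclusion for the inverse isometry.\<close>
lemma push_in_flag_iff:
  assumes iso: "isometry_pair D g V V' \<phi> \<psi>" and q: "q \<in> V"
  shows "push A \<phi> q v \<in> flag A D i (\<phi> q) \<longleftrightarrow> v \<in> flag A D i q"
proof
  have pair: "diffeo_pair V V' \<phi> \<psi>" using iso by (simp add: isometry_pair_def)
  assume "push A \<phi> q v \<in> flag A D i (\<phi> q)"
  with push_flag_subset[OF isometry_pair_sym[OF iso] diffeo_pairD(5)[OF pair q], of i]
  have "push A \<psi> (\<phi> q) (push A \<phi> q v) \<in> flag A D i (\<psi> (\<phi> q))" by blast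
  then show "v \<in> flag A D i q" by (simp add: push_inverse[OF pair q] diffeo_pairD(7)[OF pair q])
qed (use push_flag_subset[OF assms] in blast)

lemma push_flag:
  assumes iso: "isometry_pair D g V V' \<phi> \<psi>" and q: "q \<in> V"
  shows "push A \<phi> q ` flag A D i q = flag A D i (\<phi> q)"
proof
  have pair: "diffeo_pair V V' \<phi> \<psi>" using iso by (simp add: isometry_pair_def)
  show "flag A D i (\<phi> q) \<subseteq> push A \<phi> q ` flag A D i q"
  proof
    fix y assume "y \<in> flag A D i (\<phi> q)"
    then have "push A \<phi> q (push A \<psi> (\<phi> q) y) \<in> flag A D i (\<phi> q)" by (simp add: push_inverse'[OF pair q])
    then have "push A \<psi> (\<phi> q) y \<in> flag A D i q" by (simp only: push_in_flag_iff[OF assms])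
    then show "y \<in> push A \<phi> q ` flag A D i q" using push_inverse'[OF pair q, of y] by (metis image_eqI)
  qed
qed (rule push_flag_subset[OF assms])

lemma degree_push:
  assumes iso: "isometry_pair D g V V' \<phi> \<psi>" and q: "q \<in> V"
  shows "degree A D (\<phi> q) (push A \<phi> q v) = degree A D q v"
  by (simp add: degree_def push_in_flag_iff[OF assms])

lemma tensor_norm_push:
  assumes L: "\<And>x y. x \<in> S \<Longrightarrow> y \<in> S \<Longrightarrow> B' (L x) (L y) = B x y"
    and Z: "\<And>v. v \<in> set Z \<Longrightarrow> length v = i \<and> set v \<subseteq> S"
  shows "tensor_norm B' (map (map L) Z) = tensor_norm B Z"
proof -
  have "(\<Prod>j<length v. B' (map L v ! j) (map L w ! j)) = (\<Prod>j<length v. B (v ! j) (w ! j))"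
    if "v \<in> set Z" "w \<in> set Z" for v w
  proof (rule prod.cong)
    fix j assume "j \<in> {..<length v}"
    then have j: "j < length v" "j < length w" using Z that by auto
    then have "v ! j \<in> S" "w ! j \<in> S" using Z[OF that(1)] Z[OF that(2)] nth_mem by blast+
    then show "B' (map L v ! j) (map L w ! j) = B (v ! j) (w ! j)" using j L by simp
  qed simp
  then have "tensor_inner B' (map (map L) Z) (map (map L) Z) = tensor_inner B Z Z"
    unfolding tensor_inner_def by (simp add: comp_def cong: map_cong)
  then show ?thesis by (simp add: tensor_norm_def)
qed

text \<open>Pushing forward the sections that represent a tensor gives sections that represent the pushed
  tensor, with the same inner products of the factors and with pushed brackets. A bracket of no
  fields is excluded by \<open>i \<ge> 1\<close>.\<close>
lemma popp_map_push:
  assumes iso: "isometry_pair D g V V' \<phi> \<psi>" and q: "q \<in> V" and i: "i \<ge> 1"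
    and Z: "popp_map A D i q Z Y"
  shows "popp_map A D i (\<phi> q) (map (map (push A \<phi> q)) Z) (push A \<phi> q Y)"
    and "tensor_norm (g (\<phi> q)) (map (map (push A \<phi> q)) Z) = tensor_norm (g q) Z"
proof -
  have pair: "diffeo_pair V V' \<phi> \<psi>" using iso by (simp add: isometry_pair_def)
  let ?L = "push A \<phi> q" and ?F = "push_field \<phi> \<psi>"
  have lin: "linear ?L" by (rule linear_push_pair[OF iso q])
  obtain U Vss where U: "open U" "q \<in> U"
    and Vss: "\<And>Vs. Vs \<in> set Vss \<Longrightarrow> length Vs = i \<and> set Vs \<subseteq> sections A D U"
    and ZV: "Z = map (map (\<lambda>X. X q)) Vss"
    and Y: "(\<Sum>Vs\<leftarrow>Vss. nested_bracket A Vs q) - Y \<in> flag A D (i - 1) q"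
    using Z unfolding popp_map_def by blast
  obtain U' where U': "open U'" "\<phi> q \<in> U'"
    "\<And>X. X \<in> sections A D U \<Longrightarrow> ?F X \<in> sections A D U'"
    "\<And>Vs. Vs \<noteq> [] \<Longrightarrow> set Vs \<subseteq> sections A D U \<Longrightarrow>
       nested_bracket A (map ?F Vs) (\<phi> q) = ?L (nested_bracket A Vs q)"
    using push_sections[OF iso U q] by blast
  have nb: "nested_bracket A (map ?F Vs) (\<phi> q) = ?L (nested_bracket A Vs q)" if "Vs \<in> set Vss" for Vs
    using Vss[OF that] i by (intro U'(4)) auto
  have "(\<Sum>Vs\<leftarrow>map (map ?F) Vss. nested_bracket A Vs (\<phi> q)) =
      (\<Sum>Vs\<leftarrow>Vss. ?L (nested_bracket A Vs q))"
    using nb by (simp add: comp_def cong: map_cong)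
  also have "\<dots> = ?L (\<Sum>Vs\<leftarrow>Vss. nested_bracket A Vs q)"
    by (induction Vss) (simp_all add: linear_0[OF lin] linear_add[OF lin])
  finally have sum: "(\<Sum>Vs\<leftarrow>map (map ?F) Vss. nested_bracket A Vs (\<phi> q)) - ?L Y =
      ?L ((\<Sum>Vs\<leftarrow>Vss. nested_bracket A Vs q) - Y)"
    by (simp add: linear_diff[OF lin])
  have "(\<Sum>Vs\<leftarrow>map (map ?F) Vss. nested_bracket A Vs (\<phi> q)) - ?L Y \<in> flag A D (i - 1) (\<phi> q)"
    unfolding sum push_in_flag_iff[OF iso q] by (rule Y)
  moreover have "map (map ?L) Z = map (map (\<lambda>X. X (\<phi> q))) (map (map ?F) Vss)"
    by (simp add: ZV comp_def push_field_related[OF pair q])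
  moreover have "\<forall>Vs\<in>set (map (map ?F) Vss). length Vs = i \<and> set Vs \<subseteq> sections A D U'"
    using Vss U'(3) by fastforce
  ultimately show "popp_map A D i (\<phi> q) (map (map ?L) Z) (?L Y)"
    unfolding popp_map_def using U'(1,2) by blast
  show "tensor_norm (g (\<phi> q)) (map (map ?L) Z) = tensor_norm (g q) Z"
  proof (rule tensor_norm_push[where S = "D q"])
    show "g (\<phi> q) (?L x) (?L y) = g q x y" if "x \<in> D q" "y \<in> D q" for x y
      using iso q that by (simp add: isometry_pair_def isometric_on_def)
    show "length v = i \<and> set v \<subseteq> D q" if "v \<in> set Z" for v
      using that Vss U(2) unfolding ZV by (fastforce simp: sections_def)
  qed
qed

text \<open>The two infima are taken over the same set of numbers: one inclusion comes from the isometry, the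
  other from its inverse.\<close>
lemma popp_norm_push:
  assumes iso: "isometry_pair D g V V' \<phi> \<psi>" and q: "q \<in> V" and i: "i \<ge> 1"
  shows "popp_norm A D g i (\<phi> q) (push A \<phi> q Y) = popp_norm A D g i q Y"
proof -
  have pair: "diffeo_pair V V' \<phi> \<psi>" using iso by (simp add: isometry_pair_def)
  have "{tensor_norm (g (\<phi> q)) Z |Z. popp_map A D i (\<phi> q) Z (push A \<phi> q Y)} =
        {tensor_norm (g q) Z |Z. popp_map A D i q Z Y}" (is "?L = ?R")
  proof
    show "?L \<subseteq> ?R"
    proof
      fix x assume "x \<in> ?L"
      then obtain Z where Z: "x = tensor_norm (g (\<phi> q)) Z" "popp_map A D i (\<phi> q) Z (push A \<phi> q Y)" by blast
      from popp_map_push[OF isometry_pair_sym[OF iso] diffeo_pairD(5)[OF pair q] i this(2)]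
      show "x \<in> ?R" unfolding Z(1) push_inverse[OF pair q] diffeo_pairD(7)[OF pair q] by (metis (mono_tags, lifting) mem_Collect_eq)
    qed
    show "?R \<subseteq> ?L" using popp_map_push[OF iso q i] by (smt (verit, best) Collect_mono)
  qed
  then show ?thesis by (simp add: popp_norm_def)
qed

end

section \<open>The graded inner product\<close>

text \<open>\<open>popp_inner_product\<close> prescribes only the norm; polarization shows that this determines the inner
  product, so that invariance of the norm is sufficient.\<close>
lemma quotient_inner_product_polarization:
  assumes B: "quotient_inner_product F E B" and F: "subspace F" and xy: "x \<in> F" "y \<in> F"
  shows "B x y = (B (x + y) (x + y) - B x x - B y y) / 2"
proof -
  have s: "B a b = B b a" if "a \<in> F" "b \<in> F" for a b
    using B that by (simp add: quotient_inner_product_def)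
  have a: "B (a + b) c = B a c + B b c" if "a \<in> F" "b \<in> F" "c \<in> F" for a b c
    using B that by (simp add: quotient_inner_product_def)
  have xy': "x + y \<in> F" using subspace_add[OF F xy] .
  have "B (x + y) (x + y) = B x (x + y) + B y (x + y)" using a xy xy' by simp
  also have "\<dots> = B (x + y) x + B (x + y) y" using s xy xy' by simp
  also have "\<dots> = B x x + B y x + (B x y + B y y)" using a xy by simp
  finally show ?thesis using s[OF xy] by simp
qed

lemma subspace_flag: "subspace (flag A D i q)"
  by (simp add: flag_def subspace_span)

lemma flag_mono: "i \<le> j \<Longrightarrow> flag A D i q \<subseteq> flag A D j q"
  unfolding flag_def by (rule span_mono) (fastforce dest: order_trans)

lemma flag_0: "flag A D 0 q = {0}"
  by (simp add: flag_def)

text \<open>The union of the increasing flag is a subspace, and it contains all brackets, which span the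
  tangent space.\<close>
lemma in_flag_degree:
  assumes "bracket_generating A D"
  shows "v \<in> flag A D (degree A D q v) q"
proof -
  let ?G = "{nested_bracket A Vs q | Vs U. open U \<and> q \<in> U \<and> set Vs \<subseteq> sections A D U \<and> Vs \<noteq> []}"
  let ?F = "{v. \<exists>i. v \<in> flag A D i q}"
  have "subspace ?F"
  proof (rule subspaceI)
    show "0 \<in> ?F" using subspace_0[OF subspace_flag] by blast
    fix x y assume "x \<in> ?F" "y \<in> ?F"
    then obtain i j where "x \<in> flag A D i q" "y \<in> flag A D j q" by blast
    then have "x \<in> flag A D (max i j) q" "y \<in> flag A D (max i j) q"
      using flag_mono[of i "max i j" A D q] flag_mono[of j "max i j" A D q] by auto
    then have "x + y \<in> flag A D (max i j) q" by (rule subspace_add[OF subspace_flag])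
    then show "x + y \<in> ?F" by blast
  next
    fix c x assume "x \<in> ?F"
    then show "c *\<^sub>R x \<in> ?F" using subspace_scale[OF subspace_flag] by blast
  qed
  moreover have "?G \<subseteq> ?F"
  proof
    fix x assume "x \<in> ?G"
    then obtain Vs U where "open U" "q \<in> U" "set Vs \<subseteq> sections A D U" "Vs \<noteq> []" "x = nested_bracket A Vs q"
      by blast
    then have "x \<in> flag A D (length Vs) q" unfolding flag_def by (intro span_base) blast
    then show "x \<in> ?F" by blast
  qed
  ultimately have "span ?G \<subseteq> ?F" by (rule span_minimal[rotated])
  moreover have "span ?G = UNIV" using assms by (simp only: bracket_generating_def)
  ultimately have "\<exists>i. v \<in> flag A D i q" by blast
  then show ?thesis unfolding degree_def by (rule LeastI_ex)
qed

text \<open>Inner products are prescribed only on the quotients with index at least one, so the vectors that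
  are compared must have positive degree.\<close>
lemma degree_pos:
  assumes "bracket_generating A D" "v \<noteq> 0"
  shows "degree A D q v \<ge> 1"
proof (rule ccontr)
  assume "\<not> degree A D q v \<ge> 1"
  then have "degree A D q v = 0" by simp
  with in_flag_degree[OF assms(1), of v q] assms(2) show False by (simp add: flag_0)
qed

lemma gr_inner_commute:
  assumes D: "bracket_generating A D" and B: "popp_inner_product A D g q B"
    and nz: "v \<noteq> 0" "w \<noteq> 0"
  shows "gr_inner A D q B v w = gr_inner A D q B w v"
proof (cases "degree A D q v = degree A D q w")
  case True
  let ?i = "degree A D q v"
  have "quotient_inner_product (flag A D ?i q) (flag A D (?i - 1) q) (B ?i)"
    using B degree_pos[OF D nz(1)] by (simp add: popp_inner_product_def)
  then have "B ?i v w = B ?i w v"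
    using in_flag_degree[OF D, of v q] in_flag_degree[OF D, of w q] True
    by (simp add: quotient_inner_product_def)
  then show ?thesis using True by (simp add: gr_inner_def)
qed (simp add: gr_inner_def)

lemma adapted_basis_nonzero: "adapted_basis A D q v \<Longrightarrow> v a \<noteq> 0"
  unfolding adapted_basis_def using dependent_zero[of "range v"] by (metis rangeI)

context smooth_manifold
begin

lemma gr_inner_push:
  assumes iso: "isometry_pair D g V V' \<phi> \<psi>" and q: "q \<in> V" and D: "bracket_generating A D"
    and B: "popp_inner_product A D g q B" and B': "popp_inner_product A D g (\<phi> q) B'"
    and nz: "v \<noteq> 0" "w \<noteq> 0"
  shows "gr_inner A D (\<phi> q) B' (push A \<phi> q v) (push A \<phi> q w) = gr_inner A D q B v w"
proof (cases "degree A D q v = degree A D q w")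
  case True
  let ?i = "degree A D q v" and ?L = "push A \<phi> q"
  have i: "?i \<ge> 1" by (rule degree_pos[OF D nz(1)])
  have v: "v \<in> flag A D ?i q" and w: "w \<in> flag A D ?i q"
    using in_flag_degree[OF D, of v q] in_flag_degree[OF D, of w q] True by simp_all
  have lin: "linear ?L" by (rule linear_push_pair[OF iso q])
  have quot: "quotient_inner_product (flag A D ?i q) (flag A D (?i - 1) q) (B ?i)"
    "quotient_inner_product (flag A D ?i (\<phi> q)) (flag A D (?i - 1) (\<phi> q)) (B' ?i)"
    using B B' i by (simp_all add: popp_inner_product_def)
  have sq: "B' ?i (?L y) (?L y) = B ?i y y" if "y \<in> flag A D ?i q" for y
    using that B B' i popp_norm_push[OF iso q i] push_in_flag_iff[OF iso q]
    by (simp add: popp_inner_product_def)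
  have "B' ?i (?L v) (?L w) = (B' ?i (?L (v + w)) (?L (v + w)) - B' ?i (?L v) (?L v) - B' ?i (?L w) (?L w)) / 2"
    unfolding linear_add[OF lin]
    by (rule quotient_inner_product_polarization[OF quot(2) subspace_flag])
      (simp_all add: push_in_flag_iff[OF iso q] v w)
  also have "\<dots> = (B ?i (v + w) (v + w) - B ?i v v - B ?i w w) / 2"
    using sq[OF v] sq[OF w] sq[OF subspace_add[OF subspace_flag v w]] by simp
  also have "\<dots> = B ?i v w"
    by (rule quotient_inner_product_polarization[OF quot(1) subspace_flag v w, symmetric])
  finally show ?thesis by (simp only: gr_inner_def degree_push[OF iso q] True)
qed (simp add: gr_inner_def degree_push[OF iso q])

lemma adapted_basis_push:
  assumes iso: "isometry_pair D g V V' \<phi> \<psi>" and q: "q \<in> V" and v: "adapted_basis A D q v"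
  shows "adapted_basis A D (\<phi> q) (\<lambda>a. push A \<phi> q (v a))"
proof -
  have pair: "diffeo_pair V V' \<phi> \<psi>" using iso by (simp add: isometry_pair_def)
  let ?L = "push A \<phi> q"
  have lin: "linear ?L" by (rule linear_push_pair[OF iso q])
  have inj: "inj ?L" by (rule injI) (metis push_inverse[OF pair q])
  have "inj (\<lambda>a. ?L (v a))" using v inj by (simp add: adapted_basis_def inj_def)
  moreover have "independent (range (\<lambda>a. ?L (v a)))"
    using linear_independent_injective_image[OF lin _ inj_on_subset[OF inj subset_UNIV], of "range v"] v
    by (simp add: adapted_basis_def image_image)
  moreover have "span {?L (v a) |a. ?L (v a) \<in> flag A D i (\<phi> q)} = flag A D i (\<phi> q)" for i
  proof -
    have "{?L (v a) |a. ?L (v a) \<in> flag A D i (\<phi> q)} = ?L ` {v a |a. v a \<in> flag A D i q}"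
      unfolding push_in_flag_iff[OF iso q] by blast
    then show ?thesis
      using v by (simp add: linear_span_image[OF lin] push_flag[OF iso q] adapted_basis_def)
  qed
  ultimately show ?thesis by (simp add: adapted_basis_def)
qed

section \<open>Invariance of the Popp form\<close>

lemma popp_form_orthonormal:
  assumes "popp_form_at A D g q \<omega>"
  obtains B u s where "s = 1 \<or> s = -1" "popp_inner_product A D g q B" "adapted_basis A D q u"
    "\<omega> u = s" "\<And>v. adapted_basis A D q v \<Longrightarrow> \<omega> v = s * det (\<chi> a b. gr_inner A D q B (u a) (v b))"
proof -
  obtain B u s where *: "s = 1 \<or> s = -1" "popp_inner_product A D g q B" "adapted_basis A D q u"
    "\<And>a b. gr_inner A D q B (u a) (u b) = (if a = b then 1 else 0)"
    "\<And>v. adapted_basis A D q v \<Longrightarrow> \<omega> v = s * det (\<chi> a b. gr_inner A D q B (u a) (v b))"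
    using assms unfolding popp_form_at_def by blast
  have "(\<chi> a b. gr_inner A D q B (u a) (u b)) = mat 1" by (simp add: *(4) mat_def)
  then have "\<omega> u = s" using *(5)[OF *(3)] by simp
  then show ?thesis using that * by blast
qed

text \<open>Let \<open>\<eta>\<close> be the pulled back form and \<open>u\<close>, \<open>u'\<close> orthonormal adapted bases at \<open>q\<close> and \<open>\<phi> q\<close>, with
  signs \<open>s\<close>, \<open>s'\<close>. Let \<open>w\<close> be the basis at \<open>q\<close> that is mapped to \<open>u'\<close>, and \<open>d\<close> the determinant of the
  inner products of \<open>u\<close> and \<open>w\<close>. The defining formula of the Popp form gives \<open>\<omega>(u) = s\<close>,
  \<open>\<omega>(w) = s d\<close>, \<open>\<eta>(u) = s' d\<close> and \<open>\<eta>(w) = s'\<close>, the third one by symmetry of the inner product. With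
  \<open>\<eta> = c \<omega>\<close> this forces \<open>d\<^sup>2 = 1\<close> and \<open>c = \<plusminus>1\<close>.\<close>
lemma popp_form_push:
  assumes iso: "isometry_pair D g V V' \<phi> \<psi>" and q: "q \<in> V" and D: "bracket_generating A D"
    and \<omega>: "popp_form_at A D g q \<omega>" "alternating_multilinear \<omega>"
    and \<omega>': "popp_form_at A D g (\<phi> q) \<omega>'" "alternating_multilinear \<omega>'"
  shows "(\<lambda>v. \<omega>' (\<lambda>a. push A \<phi> q (v a))) = \<omega> \<or> (\<lambda>v. \<omega>' (\<lambda>a. push A \<phi> q (v a))) = (\<lambda>v. - \<omega> v)"
proof -
  have pair: "diffeo_pair V V' \<phi> \<psi>" using iso by (simp add: isometry_pair_def)
  let ?L = "push A \<phi> q"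
  let ?\<eta> = "\<lambda>v. \<omega>' (\<lambda>a. ?L (v a))"
  obtain B u s where u: "s = 1 \<or> s = -1" "popp_inner_product A D g q B" "adapted_basis A D q u"
    "\<omega> u = s" "\<And>v. adapted_basis A D q v \<Longrightarrow> \<omega> v = s * det (\<chi> a b. gr_inner A D q B (u a) (v b))"
    by (rule popp_form_orthonormal[OF \<omega>(1)]) (rule that)
  obtain B' u' s' where u': "s' = 1 \<or> s' = -1" "popp_inner_product A D g (\<phi> q) B'"
    "adapted_basis A D (\<phi> q) u'" "\<omega>' u' = s'"
    "\<And>v. adapted_basis A D (\<phi> q) v \<Longrightarrow> \<omega>' v = s' * det (\<chi> a b. gr_inner A D (\<phi> q) B' (u' a) (v b))"
    by (rule popp_form_orthonormal[OF \<omega>'(1)]) (rule that)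
  define w where "w = (\<lambda>a. push A \<psi> (\<phi> q) (u' a))"
  have Lw: "?L (w a) = u' a" for a by (simp add: w_def push_inverse'[OF pair q])
  have w: "adapted_basis A D q w"
    using adapted_basis_push[OF isometry_pair_sym[OF iso] diffeo_pairD(5)[OF pair q] u'(3)]
    by (simp add: w_def diffeo_pairD(7)[OF pair q])
  note nz = adapted_basis_nonzero[OF u(3)] adapted_basis_nonzero[OF w]
  define d where "d = det (\<chi> a b. gr_inner A D q B (u a) (w b))"
  have gr: "gr_inner A D (\<phi> q) B' (?L (w a)) (?L (u b)) = gr_inner A D q B (u b) (w a)" for a b
    using gr_inner_push[OF iso q D u(2) u'(2) nz(2,1)] gr_inner_commute[OF D u(2) nz(2,1)] by (rule trans)
  have "?\<eta> u = s' * det (\<chi> a b. gr_inner A D (\<phi> q) B' (?L (w a)) (?L (u b)))"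
    using u'(5)[OF adapted_basis_push[OF iso q u(3)]] by (simp add: Lw)
  also have "(\<chi> a b. gr_inner A D (\<phi> q) B' (?L (w a)) (?L (u b))) =
      transpose (\<chi> a b. gr_inner A D q B (u a) (w b))"
    unfolding transpose_def vec_eq_iff by (simp add: gr)
  finally have \<eta>u: "?\<eta> u = s' * d" by (simp add: d_def)
  have \<eta>w: "?\<eta> w = s'" by (simp add: Lw u'(4))
  have \<omega>w: "\<omega> w = s * d" using u(5)[OF w] by (simp add: d_def)
  have "\<omega> u \<noteq> 0" using u(1,4) by auto
  then obtain c where c: "?\<eta> = (\<lambda>v. c * \<omega> v)"
    by (rule alternating_multilinear_proportional[OF \<omega>(2)
        alternating_multilinear_compose_linear[OF \<omega>'(2) linear_push_pair[OF iso q]]])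
  have c1: "c * s = s' * d" and c2: "c * (s * d) = s'"
    using fun_cong[OF c, of u] fun_cong[OF c, of w] by (simp_all only: \<eta>u \<eta>w \<omega>w u(4))
  have nz': "s' \<noteq> 0" using u'(1) by auto
  have "s' * (d * d) = c * (s * d)" using c1 by (simp add: mult.assoc[symmetric])
  then have "s' * (d * d) = s' * 1" using c2 by simp
  then have "d * d = 1" using nz' mult_left_cancel by blast
  then have "d = 1 \<or> d = -1" by (simp add: square_eq_1_iff)
  then have "c = 1 \<or> c = -1" using c1 u(1) u'(1) by (elim disjE) simp_all
  then show ?thesis using c by (elim disjE) simp_all
qed

section \<open>Ratios of volume forms\<close>

lemma form_rep_chart:
  "c \<in> A \<Longrightarrow> q \<in> fst c \<Longrightarrow>
    form_rep A c \<omega> (snd c q) v = \<omega> q (\<lambda>a. differential c (chart_at A q) id q (v a))"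
  by (simp add: form_rep_def chart_inv_chart change_eq_differential Let_def)

lemma alternating_form_rep:
  assumes "alternating_multilinear (\<omega> q)" "c \<in> A" "q \<in> fst c"
  shows "alternating_multilinear (form_rep A c \<omega> (snd c q))"
proof -
  have "linear (differential c (chart_at A q) id q)"
    by (rule linear_differential[OF smooth_map_id]) (simp_all add: assms chart_at)
  note alternating_multilinear_compose_linear[OF assms(1) this]
  moreover have "form_rep A c \<omega> (snd c q) = (\<lambda>v. \<omega> q (\<lambda>a. differential c (chart_at A q) id q (v a)))"
    by (rule ext) (rule form_rep_chart[OF assms(2,3)])
  ultimately show ?thesis by (simp only:)
qed

lemma volume_form_alternating: "volume_form A P \<Longrightarrow> alternating_multilinear (P q)"
  by (simp add: volume_form_def smooth_form_def)

text \<open>A form that vanishes on the coordinate frame vanishes on all frames.\<close>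
lemma volume_form_rep_nonzero:
  assumes P: "volume_form A P" and c: "c \<in> A" "q \<in> fst c"
  shows "form_rep A c P (snd c q) std_frame \<noteq> 0"
proof
  let ?d = "chart_at A q"
  assume 0: "form_rep A c P (snd c q) std_frame = 0"
  obtain v where v: "P q v \<noteq> 0" using P by (auto simp: volume_form_def)
  have "differential c ?d id q (differential ?d c id q x) = x" for x
    using differential_compose[OF smooth_map_id open_UNIV smooth_map_id, of q ?d c ?d x]
    by (simp add: chart_at c differential_id)
  then have "P q v = form_rep A c P (snd c q) (\<lambda>a. differential ?d c id q (v a))"
    by (simp add: form_rep_chart c)
  also have "\<dots> = 0"
    by (subst alternating_multilinear_det[OF alternating_form_rep[OF volume_form_alternating[OF P] c]]) (simp only: 0 mult_zero_left)
  finally show False using v by simp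
qed

lemma continuous_form_rep:
  assumes "smooth_form A \<omega>" "c \<in> A"
  shows "continuous_on (fst c) (\<lambda>q. form_rep A c \<omega> (snd c q) v)"
proof -
  have "smooth_on (snd c ` fst c) (\<lambda>x. form_rep A c \<omega> x v)"
    using assms by (simp add: smooth_form_def)
  from continuous_on_compose2[OF smooth_on_continuous_on[OF this] continuous_on_chart[OF assms(2)] subset_refl]
  show ?thesis .
qed

text \<open>In a chart \<open>f\<close> is the quotient of the smooth coefficients of the two forms.\<close>
lemma volume_form_ratio:
  assumes P: "volume_form A P" and \<nu>: "smooth_form A \<nu>"
  obtains f where "continuous_on UNIV f" "\<And>q. \<nu> q = (\<lambda>v. f q * P q v)"
proof -
  have "\<exists>c. \<nu> q = (\<lambda>v. c * P q v)" for q
  proof -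
    obtain u where "P q u \<noteq> 0" using P by (auto simp: volume_form_def)
    moreover have "alternating_multilinear (\<nu> q)" using \<nu> by (simp add: smooth_form_def)
    ultimately obtain c where "\<nu> q = (\<lambda>v. c * P q v)"
      using alternating_multilinear_proportional[OF volume_form_alternating[OF P, of q]] by blast
    then show ?thesis ..
  qed
  then have "\<forall>q. \<exists>c. \<nu> q = (\<lambda>v. c * P q v)" ..
  from choice[OF this] obtain f where f: "\<And>q. \<nu> q = (\<lambda>v. f q * P q v)" by blast
  have "continuous_on UNIV f"
  proof (rule continuous_on_locally_open)
    fix q0
    define c where "c = chart_at A q0"
    have c: "c \<in> A" "q0 \<in> fst c" by (simp_all add: c_def chart_at)
    have Ps: "smooth_form A P" using P by (simp add: volume_form_def)
    have "continuous_on (fst c) (\<lambda>q. form_rep A c \<nu> (snd c q) std_frame / form_rep A c P (snd c q) std_frame)"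
      using volume_form_rep_nonzero[OF P c(1)]
      by (intro continuous_on_divide continuous_form_rep[OF \<nu> c(1)] continuous_form_rep[OF Ps c(1)]) auto
    moreover have "form_rep A c \<nu> (snd c q) std_frame / form_rep A c P (snd c q) std_frame = f q"
      if "q \<in> fst c" for q
      using volume_form_rep_nonzero[OF P c(1) that] by (simp add: form_rep_chart[OF c(1) that] f)
    ultimately have "continuous_on (fst c) f" by (rule continuous_on_eq)
    moreover have "open (fst c)" using is_chart[OF c(1)] by (simp add: is_chart_def)
    ultimately show "\<exists>N. open N \<and> q0 \<in> N \<and> continuous_on N f" using c(2) by blast
  qed
  then show ?thesis using that f by blast
qed

text \<open>Both sides are the differential of \<open>\<phi>\<close> from the chart \<open>c\<close> to the chart chosen at \<open>\<phi> q\<close>.\<close>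
lemma push_differential:
  assumes \<phi>: "smooth_map_on A W \<phi>" "open W" and q: "q \<in> W"
    and charts: "c \<in> A" "d \<in> A" "q \<in> fst c" "\<phi> q \<in> fst d"
  shows "push A \<phi> q (differential c (chart_at A q) id q x) =
    differential d (chart_at A (\<phi> q)) id (\<phi> q) (differential c d \<phi> q x)"
proof -
  have "push A \<phi> q (differential c (chart_at A q) id q x) = differential c (chart_at A (\<phi> q)) \<phi> q x"
    using differential_compose[OF smooth_map_id open_UNIV \<phi>(1), of q c "chart_at A q" "chart_at A (\<phi> q)" x]
    by (simp add: push_eq_differential chart_at charts q)
  also have "\<dots> = differential d (chart_at A (\<phi> q)) id (\<phi> q) (differential c d \<phi> q x)"
    using differential_compose[OF \<phi> smooth_map_id q, of c d "chart_at A (\<phi> q)" x]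
    by (simp add: chart_at charts)
  finally show ?thesis .
qed

text \<open>The coefficient of a pulled back form is the coefficient of the form times the Jacobian
  determinant.\<close>
lemma form_rep_pullback:
  assumes \<phi>: "smooth_map_on A W \<phi>" "open W" and q: "q \<in> W"
    and charts: "c \<in> A" "d \<in> A" "q \<in> fst c" "\<phi> q \<in> fst d"
    and \<omega>: "alternating_multilinear (\<omega> (\<phi> q))"
  shows "form_rep A c (pullback A \<phi> \<omega>) (snd c q) std_frame =
    form_rep A d \<omega> (snd d (\<phi> q)) std_frame * det (\<chi> a. differential c d \<phi> q (axis a 1))"
proof -
  have "form_rep A c (pullback A \<phi> \<omega>) (snd c q) std_frame =
      form_rep A d \<omega> (snd d (\<phi> q)) (\<lambda>a. differential c d \<phi> q (axis a 1))"
    unfolding form_rep_chart[OF charts(1,3)] form_rep_chart[OF charts(2,4)] pullback_def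
      push_differential[OF \<phi> q charts] ..
  also have "\<dots> = form_rep A d \<omega> (snd d (\<phi> q)) std_frame * det (\<chi> a. differential c d \<phi> q (axis a 1))"
    by (rule alternating_multilinear_det[OF alternating_form_rep[where \<omega> = \<omega>, OF \<omega> charts(2,4)]])
  finally show ?thesis .
qed

text \<open>By the preceding formula the ratio is a Jacobian determinant times a quotient of coefficients of
  \<open>P\<close>, all of which are continuous in fixed charts around \<open>q0\<close> and \<open>\<phi> q0\<close>.\<close>
lemma continuous_pullback_ratio:
  assumes P: "volume_form A P" and \<phi>: "smooth_map_on A W \<phi>" "open W"
    and s: "\<And>q. q \<in> W \<Longrightarrow> pullback A \<phi> P q = (\<lambda>v. s q * P q v)"
  shows "continuous_on W s"
proof (rule continuous_on_locally_open)
  fix q0 assume q0: "q0 \<in> W"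
  define c d where "c = chart_at A q0" and "d = chart_at A (\<phi> q0)"
  have c: "c \<in> A" "q0 \<in> fst c" and d: "d \<in> A" "\<phi> q0 \<in> fst d"
    by (simp_all add: c_def d_def chart_at)
  have Ps: "smooth_form A P" using P by (simp add: volume_form_def)
  have opn: "open (fst c)" "open (fst d)" using is_chart c d by (simp_all add: is_chart_def)
  let ?N = "fst c \<inter> W \<inter> \<phi> -` fst d"
  let ?h = "\<lambda>q. form_rep A d P (snd d (\<phi> q)) std_frame * det (\<chi> a. differential c d \<phi> q (axis a 1))
      / form_rep A c P (snd c q) std_frame"
  have N: "open ?N"
    using open_Int[OF opn(1) smooth_map_on_preimage_open[OF \<phi> opn(2)]] by (simp add: Int_assoc)
  have "continuous_on W \<phi>" using \<phi>(1) by (simp add: smooth_map_on_def)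
  then have "continuous_on ?N \<phi>" by (rule continuous_on_subset) blast
  from continuous_on_compose2[OF continuous_form_rep[OF Ps d(1)] this]
  have 1: "continuous_on ?N (\<lambda>q. form_rep A d P (snd d (\<phi> q)) std_frame)" by blast
  have "continuous_on ?N (snd c)"
    by (rule continuous_on_subset[OF continuous_on_chart[OF c(1)]]) blast
  then have dc: "continuous_on ?N (\<lambda>q. differential c d \<phi> q x)" for x
    unfolding differential_def
    by (rule continuous_on_compose2[OF smooth_on_continuous_on[OF
          smooth_on_derivative[OF smooth_coord_rep[OF \<phi>(1) c(1) d(1)]]]]) blast
  have 2: "continuous_on ?N (\<lambda>q. det (\<chi> a. differential c d \<phi> q (axis a 1)))"
    unfolding det_def
  proof (rule continuous_on_sum, rule continuous_on_mult[OF continuous_on_const], rule continuous_on_prod)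
    fix p and i :: 'n
    show "continuous_on ?N (\<lambda>q. (\<chi> a. differential c d \<phi> q (axis a 1)) $ i $ p i)"
      using continuous_on_component[OF dc, of "axis i 1" "p i"] by simp
  qed
  have 3: "continuous_on ?N (\<lambda>q. form_rep A c P (snd c q) std_frame)"
    by (rule continuous_on_subset[OF continuous_form_rep[OF Ps c(1)]]) blast
  have "continuous_on ?N ?h"
    by (rule continuous_on_divide[OF continuous_on_mult[OF 1 2] 3]) (use volume_form_rep_nonzero[OF P c(1)] in blast)
  moreover have "?h q = s q" if "q \<in> ?N" for q
  proof -
    have q: "q \<in> fst c" "q \<in> W" "\<phi> q \<in> fst d" using that by auto
    have "form_rep A c (pullback A \<phi> P) (snd c q) std_frame = s q * form_rep A c P (snd c q) std_frame"
      unfolding form_rep_chart[OF c(1) q(1)] s[OF q(2)] ..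
    with form_rep_pullback[where \<omega> = P, OF \<phi> q(2) c(1) d(1) q(1,3) volume_form_alternating[OF P]]
    show ?thesis using volume_form_rep_nonzero[OF P c(1) q(1)] by (metis nonzero_mult_div_cancel_right)
  qed
  ultimately have "continuous_on ?N s" by (rule continuous_on_eq)
  moreover have "q0 \<in> ?N" using c d q0 by simp
  ultimately show "\<exists>N. open N \<and> q0 \<in> N \<and> continuous_on N s" using N by blast
qed

section \<open>Isometries and orientation\<close>

lemma smooth_map_compose:
  assumes \<alpha>: "smooth_map_on A UNIV \<alpha>" and \<beta>: "smooth_map_on A UNIV \<beta>"
  shows "smooth_map_on A UNIV (\<beta> \<circ> \<alpha>)"
  unfolding smooth_map_on_def
proof (intro conjI ballI smooth_on_locally)
  show "continuous_on UNIV (\<beta> \<circ> \<alpha>)"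
    using \<alpha> \<beta> by (intro continuous_on_compose) (auto simp: smooth_map_on_def intro: continuous_on_subset)
  fix c e x assume c: "c \<in> A" and e: "e \<in> A"
    and "x \<in> snd c ` (fst c \<inter> UNIV \<inter> (\<beta> \<circ> \<alpha>) -` fst e)"
  then obtain p where p: "p \<in> fst c" "\<beta> (\<alpha> p) \<in> fst e" "x = snd c p" by auto
  define d where "d = chart_at A (\<alpha> p)"
  have d: "d \<in> A" "\<alpha> p \<in> fst d" by (simp_all add: d_def chart_at)
  have opn: "open (fst d)" "open (fst e)" using is_chart d e by (simp_all add: is_chart_def)
  define W where "W = \<alpha> -` (fst d \<inter> \<beta> -` fst e)"
  have "open (UNIV \<inter> \<beta> -` fst e)" by (rule smooth_map_on_preimage_open[OF \<beta> open_UNIV opn(2)])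
  then have "open (fst d \<inter> \<beta> -` fst e)" using opn(1) by auto
  then have "open (UNIV \<inter> W)" unfolding W_def by (rule smooth_map_on_preimage_open[OF \<alpha> open_UNIV])
  then have W: "open W" by simp
  let ?N = "snd c ` (fst c \<inter> W)"
  have N: "open ?N" by (rule open_chart_image[OF c W])
  have "smooth_on ?N (\<lambda>x. coord_rep d e \<beta> (coord_rep c d \<alpha> x))"
  proof (rule smooth_on_compose[OF N _ smooth_coord_rep[OF \<beta> d(1) e]])
    show "coord_rep c d \<alpha> ` ?N \<subseteq> snd d ` (fst d \<inter> UNIV \<inter> \<beta> -` fst e)"
      by (auto simp: coord_rep_chart c W_def)
    show "smooth_on ?N (coord_rep c d \<alpha>)"
      by (rule smooth_on_subset[OF smooth_coord_rep[OF \<alpha> c d(1)]]) (auto simp: W_def)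
  qed
  then have "smooth_on ?N (snd e \<circ> (\<beta> \<circ> \<alpha>) \<circ> chart_inv c)"
    by (rule smooth_on_cong[OF N, rotated])
      (auto simp: W_def coord_rep_chart c d chart_inv_chart)
  moreover have "x \<in> ?N" using p d by (auto simp: W_def)
  ultimately show "\<exists>N. open N \<and> x \<in> N \<and> smooth_on N (snd e \<circ> (\<beta> \<circ> \<alpha>) \<circ> chart_inv c)"
    using N by blast
qed

lemma Iso_compose:
  assumes \<phi>: "\<phi> \<in> Iso A D g" and \<psi>: "\<psi> \<in> Iso A D g"
  shows "\<psi> \<circ> \<phi> \<in> Iso A D g"
proof -
  have sm: "smooth_map_on A UNIV \<phi>" "smooth_map_on A UNIV \<psi>"
    "smooth_map_on A UNIV (inv \<phi>)" "smooth_map_on A UNIV (inv \<psi>)"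
    and bij: "bij \<phi>" "bij \<psi>"
    and iso: "isometric_on A D g UNIV \<phi>" "isometric_on A D g UNIV \<psi>"
    using \<phi> \<psi> by (simp_all add: Iso_def diffeo_def)
  have "inv (\<psi> \<circ> \<phi>) = inv \<phi> \<circ> inv \<psi>" by (rule o_inv_distrib[OF bij(2,1)])
  then have "diffeo A (\<psi> \<circ> \<phi>)"
    using smooth_map_compose sm bij by (simp add: diffeo_def bij_comp)
  moreover have "isometric_on A D g UNIV (\<psi> \<circ> \<phi>)"
  proof -
    have push: "push A (\<psi> \<circ> \<phi>) q = push A \<psi> (\<phi> q) \<circ> push A \<phi> q" for q
      using push_compose[OF sm(1) open_UNIV sm(2)] by (simp add: fun_eq_iff)
    show ?thesis
      unfolding isometric_on_def push
    proof (intro ballI conjI)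
      fix q
      have "push A \<phi> q ` D q = D (\<phi> q)" "push A \<psi> (\<phi> q) ` D (\<phi> q) = D (\<psi> (\<phi> q))"
        using iso by (simp_all add: isometric_on_def)
      then show "(push A \<psi> (\<phi> q) \<circ> push A \<phi> q) ` D q = D ((\<psi> \<circ> \<phi>) q)"
        by (simp only: image_comp[symmetric] comp_apply)
      fix X Y assume XY: "X \<in> D q" "Y \<in> D q"
      have "push A \<phi> q X \<in> D (\<phi> q)" "push A \<phi> q Y \<in> D (\<phi> q)"
        using iso(1) XY by (auto simp: isometric_on_def)
      then show "g ((\<psi> \<circ> \<phi>) q) ((push A \<psi> (\<phi> q) \<circ> push A \<phi> q) X) ((push A \<psi> (\<phi> q) \<circ> push A \<phi> q) Y) = g q X Y"
        using iso XY by (simp add: isometric_on_def)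
    qed
  qed
  ultimately show ?thesis by (simp add: Iso_def)
qed

lemma local_isometry_pair:
  assumes "local_isometry_on A D g W \<phi>" "q \<in> W"
  obtains V where "q \<in> V" "isometry_pair D g V (\<phi> ` V) \<phi> (inv_into V \<phi>)"
proof -
  obtain V where V: "open V" "q \<in> V" "V \<subseteq> W" "inj_on \<phi> V" "open (\<phi> ` V)"
    "smooth_map_on A V \<phi>" "smooth_map_on A (\<phi> ` V) (inv_into V \<phi>)"
    using assms unfolding local_isometry_on_def local_diffeo_on_def by blast
  then have "diffeo_pair V (\<phi> ` V) \<phi> (inv_into V \<phi>)"
    by (auto simp: diffeo_pair_def f_inv_into_f inv_into_into)
  moreover have "isometric_on A D g V \<phi>"
    using assms(1) V(3) unfolding local_isometry_on_def isometric_on_def by blast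
  ultimately show ?thesis using that V(2) by (simp add: isometry_pair_def)
qed

lemma Iso_imp_local_isometry: "\<phi> \<in> Iso A D g \<Longrightarrow> local_isometry_on A D g UNIV \<phi>"
  unfolding local_isometry_on_def local_diffeo_on_def Iso_def diffeo_def
  by (auto simp: bij_def intro!: exI[of _ UNIV])

lemma popp_volume_form:
  assumes "popp_volume A D g P"
  shows "volume_form A P"
  unfolding volume_form_def
proof (intro conjI allI)
  show "smooth_form A P" using assms by (simp add: popp_volume_def)
  fix q
  have "popp_form_at A D g q (P q)" using assms by (simp add: popp_volume_def)
  then obtain u where "P q u = 1 \<or> P q u = -1" using popp_form_orthonormal by metis
  then have "P q u \<noteq> 0" by auto
  then show "\<exists>v. P q v \<noteq> 0" by blast
qed

lemma popp_volume_pullback: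
  assumes D: "bracket_generating A D" and P: "popp_volume A D g P"
    and iso: "local_isometry_on A D g W \<phi>" and q: "q \<in> W"
  shows "pullback A \<phi> P q = P q \<or> pullback A \<phi> P q = (\<lambda>v. - P q v)"
proof -
  obtain V where V: "q \<in> V" "isometry_pair D g V (\<phi> ` V) \<phi> (inv_into V \<phi>)"
    using local_isometry_pair[OF iso q] by blast
  have pullback: "pullback A \<phi> P q = (\<lambda>v. P (\<phi> q) (\<lambda>a. push A \<phi> q (v a)))"
    by (simp add: fun_eq_iff pullback_def)
  have "popp_form_at A D g p (P p)" "alternating_multilinear (P p)" for p
    using P by (simp_all add: popp_volume_def smooth_form_def)
  from popp_form_push[OF V(2,1) D this this] show ?thesis by (simp add: pullback)
qed

lemma volume_form_scale:
  assumes "volume_form A P" "c \<noteq> 0"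
  shows "volume_form A (\<lambda>q v. c * P q v)"
  unfolding volume_form_def smooth_form_def
proof (intro conjI allI ballI)
  have P: "alternating_multilinear (P q)" for q by (rule volume_form_alternating[OF assms(1)])
  show "alternating_multilinear (\<lambda>v. c * P q v)" for q
    unfolding alternating_multilinear_def
  proof (intro conjI allI impI)
    show "linear (\<lambda>x. c * P q (v(a := x)))" for v a
      using linear_compose_scale_right[OF alternating_multilinear_linear[OF P], of c] by simp
    show "c * P q v = 0" if "a \<noteq> b \<and> v a = v b" for v a b
      using alternating_multilinear_repeat[OF P, of a b v] that by simp
  qed
  show "\<exists>v. c * P q v \<noteq> 0" for q using assms by (simp add: volume_form_def)
  fix d v assume d: "d \<in> A"
  have "smooth_on (snd d ` fst d) (\<lambda>x. form_rep A d P x v)"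
    using assms(1) d by (simp add: volume_form_def smooth_form_def)
  from smooth_on_bounded_linear[OF bounded_linear_mult_right _ this, of c]
  show "smooth_on (snd d ` fst d) (\<lambda>x. form_rep A d (\<lambda>q v. c * P q v) x v)"
    using is_chart[OF d] by (simp add: form_rep_def is_chart_def Let_def)
qed

lemma orientation_preserving_pullback:
  assumes P: "volume_form A P" and or: "orientation_preserving_on A W \<phi>" and q: "q \<in> W"
    and sign: "pullback A \<phi> P q = P q \<or> pullback A \<phi> P q = (\<lambda>v. - P q v)"
  shows "pullback A \<phi> P q = P q"
proof -
  obtain r where r: "r > 0" "\<And>v. pullback A \<phi> P q v = r * P q v"
    using or P q unfolding orientation_preserving_on_def by blast
  obtain v where v: "P q v \<noteq> 0" using P by (auto simp: volume_form_def)
  have "pullback A \<phi> P q \<noteq> (\<lambda>v. - P q v)"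
  proof
    assume "pullback A \<phi> P q = (\<lambda>v. - P q v)"
    then have "(r + 1) * P q v = 0" using r(2)[of v] by (simp add: algebra_simps)
    then show False using r(1) v by simp
  qed
  then show ?thesis using sign by blast
qed

text \<open>Any volume form is \<open>h P\<close> with a continuous function \<open>h\<close> without zeros, which has constant sign by
  connectedness; so it is enough to test the orientation on \<open>P\<close>.\<close>
lemma orientation_preservingI:
  assumes conn: "connected (UNIV :: 'a set)" and P: "volume_form A P"
    and pres: "\<And>q. pullback A \<phi> P q = P q"
  shows "orientation_preserving_on A UNIV \<phi>"
  unfolding orientation_preserving_on_def
proof (intro allI impI ballI)
  fix \<nu> q assume \<nu>: "volume_form A \<nu>"
  then obtain h where h: "continuous_on UNIV h" "\<And>q. \<nu> q = (\<lambda>v. h q * P q v)"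
    using volume_form_ratio[OF P] by (auto simp: volume_form_def)
  have nz: "h p \<noteq> 0" for p
  proof -
    obtain v where "\<nu> p v \<noteq> 0" using \<nu> by (auto simp: volume_form_def)
    then show ?thesis by (simp add: h(2))
  qed
  have "connected (range h)" by (rule connected_continuous_image[OF h(1) conn])
  then have pos: "h (\<phi> q) / h q > 0"
    using nz connectedD_interval[of "range h" "h q" "h (\<phi> q)" 0]
      connectedD_interval[of "range h" "h (\<phi> q)" "h q" 0]
    by (smt (verit) divide_pos_pos divide_neg_neg rangeE rangeI)
  have "pullback A \<phi> \<nu> q v = h (\<phi> q) / h q * \<nu> q v" for v
    using fun_cong[OF pres[of q], of v] nz[of q] by (simp add: pullback_def h(2))
  then show "\<exists>r>0. \<forall>v. pullback A \<phi> \<nu> q v = r * \<nu> q v" using pos by blast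
qed

text \<open>The sign by which an isometry multiplies \<open>P\<close> is continuous, hence constant.\<close>
lemma isometry_orientation_dichotomy:
  assumes conn: "connected (UNIV :: 'a set)" and D: "bracket_generating A D"
    and P: "popp_volume A D g P" and \<phi>: "\<phi> \<in> Iso A D g"
  shows "(\<forall>q. pullback A \<phi> P q = P q) \<or> (\<forall>q. pullback A \<phi> P q = (\<lambda>v. - P q v))"
proof -
  have sign: "pullback A \<phi> P q = P q \<or> pullback A \<phi> P q = (\<lambda>v. - P q v)" for q
    using popp_volume_pullback[OF D P Iso_imp_local_isometry[OF \<phi>]] by simp
  define s :: "'a \<Rightarrow> real" where "s q = (if pullback A \<phi> P q = P q then 1 else -1)" for q
  have s: "pullback A \<phi> P q = (\<lambda>v. s q * P q v)" for q
    using sign[of q] by (auto simp: s_def)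
  have "continuous_on UNIV s"
    using \<phi> s by (intro continuous_pullback_ratio[OF popp_volume_form[OF P]]) (auto simp: Iso_def diffeo_def)
  moreover have "finite (range s)"
    by (rule finite_subset[of _ "{1, -1}"]) (auto simp: s_def)
  ultimately have "s constant_on UNIV" by (rule continuous_finite_range_constant[OF conn])
  then obtain k where "\<And>q. s q = k" by (auto simp: constant_on_def)
  moreover have "s undefined = 1 \<or> s undefined = -1" by (simp add: s_def)
  ultimately have "(\<forall>q. s q = 1) \<or> (\<forall>q. s q = -1)" by metis
  then show ?thesis using s by auto
qed

section \<open>Uniqueness of the invariant volume form\<close>

text \<open>The ratio \<open>f = \<mu>/P\<close> is invariant under the isometries that preserve orientation, but only the
  full isometry group is assumed to be transitive. If \<open>\<phi>\<close> maps \<open>p\<close> to \<open>q1\<close> and \<open>\<psi>\<close> maps \<open>q1\<close> to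
  \<open>q2\<close>, then one of \<open>\<phi>\<close>, \<open>\<psi>\<close>, \<open>\<psi> \<circ> \<phi>\<close> preserves orientation, so two of the values of \<open>f\<close> at the
  three points agree. A continuous function with at most two values on a connected space is
  constant.\<close>
lemma invariant_volume_form:
  assumes conn: "connected (UNIV :: 'a set)" and D: "bracket_generating A D"
    and P: "popp_volume A D g P" and trans: "\<forall>p q. \<exists>\<phi>\<in>Iso A D g. \<phi> p = q"
    and \<mu>: "volume_form A \<mu>"
    and inv: "\<And>\<phi>. \<phi> \<in> Iso A D g \<Longrightarrow> orientation_preserving_on A UNIV \<phi> \<Longrightarrow> volume_preserving_on A UNIV \<mu> \<phi>"
  shows "\<exists>c. c \<noteq> 0 \<and> \<mu> = (\<lambda>q v. c * P q v)"
proof -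
  note Pv = popp_volume_form[OF P]
  obtain f where f: "continuous_on UNIV f" "\<And>q. \<mu> q = (\<lambda>v. f q * P q v)"
    using volume_form_ratio[OF Pv] \<mu> by (auto simp: volume_form_def)
  define pres where "pres \<phi> \<longleftrightarrow> (\<forall>q. pullback A \<phi> P q = P q)" for \<phi>
  have f_pres: "f (\<phi> q) = f q" if \<phi>: "\<phi> \<in> Iso A D g" "pres \<phi>" for \<phi> q
  proof -
    have "volume_preserving_on A UNIV \<mu> \<phi>"
      by (rule inv[OF \<phi>(1) orientation_preservingI[OF conn Pv]]) (use \<phi>(2) in \<open>simp add: pres_def\<close>)
    then have "pullback A \<phi> \<mu> q v = \<mu> q v" for v by (simp add: volume_preserving_on_def)
    then have "f (\<phi> q) * P (\<phi> q) (\<lambda>a. push A \<phi> q (v a)) = f q * P q v" for v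
      by (simp only: pullback_def f(2))
    moreover obtain v where v: "P q v \<noteq> 0" using Pv by (auto simp: volume_form_def)
    moreover have "P (\<phi> q) (\<lambda>a. push A \<phi> q (v a)) = P q v"
      using \<phi>(2) unfolding pres_def by (metis pullback_def)
    ultimately show ?thesis by (metis mult_right_cancel)
  qed
  have comp: "pres (\<psi> \<circ> \<phi>)" if \<phi>: "\<phi> \<in> Iso A D g" "\<not> pres \<phi>" and \<psi>: "\<psi> \<in> Iso A D g" "\<not> pres \<psi>" for \<phi> \<psi>
  proof -
    have neg: "pullback A \<phi> P q = (\<lambda>v. - P q v)" "pullback A \<psi> P q = (\<lambda>v. - P q v)" for q
      using isometry_orientation_dichotomy[OF conn D P] \<phi> \<psi> unfolding pres_def by blast+
    have sm: "smooth_map_on A UNIV \<phi>" "smooth_map_on A UNIV \<psi>"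
      using \<phi> \<psi> by (simp_all add: Iso_def diffeo_def)
    have "pullback A (\<psi> \<circ> \<phi>) P q v = P q v" for q v
    proof -
      have "pullback A (\<psi> \<circ> \<phi>) P q v = pullback A \<psi> P (\<phi> q) (\<lambda>a. push A \<phi> q (v a))"
        by (simp add: pullback_def push_compose[OF sm(1) open_UNIV sm(2), symmetric])
      also have "\<dots> = - pullback A \<phi> P q v" unfolding neg(2) by (simp add: pullback_def)
      also have "\<dots> = P q v" by (simp add: neg(1))
      finally show ?thesis .
    qed
    then show ?thesis by (simp add: pres_def fun_eq_iff)
  qed
  define p :: 'a where "p = undefined"
  \<comment> \<open>Two isometries that reverse orientation compose to one that preserves it, and it maps \<open>p\<close> to \<open>q2\<close>.\<close>
  have two: "f q2 = f p \<or> f q1 = f p \<or> f q1 = f q2" for q1 q2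
  proof (rule ccontr)
    assume ne: "\<not> (f q2 = f p \<or> f q1 = f p \<or> f q1 = f q2)"
    obtain \<phi> \<psi> where \<phi>: "\<phi> \<in> Iso A D g" "\<phi> p = q1" and \<psi>: "\<psi> \<in> Iso A D g" "\<psi> q1 = q2"
      using trans by meson
    have "\<not> pres \<phi>" "\<not> pres \<psi>" using f_pres[OF \<phi>(1), of p] f_pres[OF \<psi>(1), of q1] \<phi>(2) \<psi>(2) ne by auto
    then have "f ((\<psi> \<circ> \<phi>) p) = f p" by (intro f_pres Iso_compose \<phi> \<psi> comp)
    then show False using ne \<phi>(2) \<psi>(2) by simp
  qed
  have "finite (range f)"
  proof (cases "\<exists>q1. f q1 \<noteq> f p")
    case True
    then obtain q1 where q1: "f q1 \<noteq> f p" ..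
    have "range f \<subseteq> {f p, f q1}" using two[of q1] two q1 by auto
    then show ?thesis by (rule finite_subset) simp
  next
    case False
    then have "range f \<subseteq> {f p}" by auto
    then show ?thesis by (rule finite_subset) simp
  qed
  then have "f constant_on UNIV" by (rule continuous_finite_range_constant[OF conn f(1)])
  then obtain c where c: "\<And>q. f q = c" by (auto simp: constant_on_def)
  have "\<mu> = (\<lambda>q v. c * P q v)" using f(2) c by (simp add: fun_eq_iff)
  moreover have "c \<noteq> 0" using \<mu> f(2) c by (auto simp: volume_form_def)
  ultimately show ?thesis by blast
qed

lemma popp_volume_scale_invariant:
  assumes D: "bracket_generating A D" and P: "popp_volume A D g P"
    and iso: "local_isometry_on A D g W \<phi>" and or: "orientation_preserving_on A W \<phi>"
  shows "volume_preserving_on A W (\<lambda>q v. c * P q v) \<phi>"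
  unfolding volume_preserving_on_def
proof
  fix q assume q: "q \<in> W"
  have "pullback A \<phi> P q = P q"
    by (rule orientation_preserving_pullback[OF popp_volume_form[OF P] or q popp_volume_pullback[OF D P iso q]])
  from fun_cong[OF this] show "pullback A \<phi> (\<lambda>q v. c * P q v) q = (\<lambda>v. c * P q v)"
    by (simp add: fun_eq_iff pullback_def)
qed

end

theorem proposition6:
  fixes A :: "('a::{t2_space, second_countable_topology}, 'n::finite) chart set"
    and D :: "'a \<Rightarrow> (real^'n) set"
    and g :: "'a \<Rightarrow> real^'n \<Rightarrow> real^'n \<Rightarrow> real"
    and P :: "('a, 'n) form"
  assumes "sub_riemannian_manifold A D g"
    and "equiregular A D"
    and "popp_volume A D g P"
    and "\<forall>p q. \<exists>\<phi>\<in>Iso A D g. \<phi> p = q"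
  shows "(\<forall>\<mu>. (volume_form A \<mu> \<and>
              (\<forall>\<phi>\<in>Iso A D g. orientation_preserving_on A UNIV \<phi> \<longrightarrow> volume_preserving_on A UNIV \<mu> \<phi>))
            \<longleftrightarrow> (\<exists>c. c \<noteq> 0 \<and> \<mu> = (\<lambda>q v. c * P q v)))
       \<and> (\<forall>\<mu>. (volume_form A \<mu> \<and>
              (\<forall>W \<phi>. local_isometry_on A D g W \<phi> \<and> orientation_preserving_on A W \<phi>
                 \<longrightarrow> volume_preserving_on A W \<mu> \<phi>))
            \<longleftrightarrow> (\<exists>c. c \<noteq> 0 \<and> \<mu> = (\<lambda>q v. c * P q v)))
       \<and> (\<forall>W \<phi>. local_isometry_on A D g W \<phi> \<longrightarrow>
              (\<forall>q\<in>W. pullback A \<phi> P q = P q \<or> pullback A \<phi> P q = (\<lambda>v. - P q v)))"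
proof -
  interpret smooth_manifold A
    using assms(1) by unfold_locales (simp add: sub_riemannian_manifold_def)
  have conn: "connected (UNIV :: 'a set)" and D: "bracket_generating A D"
    using assms(1) by (simp_all add: sub_riemannian_manifold_def)
  note unique = invariant_volume_form[OF conn D assms(3,4)]
  note scale = volume_form_scale[OF popp_volume_form[OF assms(3)]]
  note invariant = popp_volume_scale_invariant[OF D assms(3)]
  show ?thesis
  proof (intro conjI allI impI ballI)
    fix \<mu>
    show "(volume_form A \<mu> \<and>
              (\<forall>\<phi>\<in>Iso A D g. orientation_preserving_on A UNIV \<phi> \<longrightarrow> volume_preserving_on A UNIV \<mu> \<phi>))
            \<longleftrightarrow> (\<exists>c. c \<noteq> 0 \<and> \<mu> = (\<lambda>q v. c * P q v))"
      using unique[of \<mu>] scale invariant[OF Iso_imp_local_isometry] by blast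
    show "(volume_form A \<mu> \<and>
              (\<forall>W \<phi>. local_isometry_on A D g W \<phi> \<and> orientation_preserving_on A W \<phi>
                 \<longrightarrow> volume_preserving_on A W \<mu> \<phi>))
            \<longleftrightarrow> (\<exists>c. c \<noteq> 0 \<and> \<mu> = (\<lambda>q v. c * P q v))"
      using unique[of \<mu>] scale invariant Iso_imp_local_isometry by blast
  next
    fix W \<phi> q assume "local_isometry_on A D g W \<phi>" "q \<in> W"
    then show "pullback A \<phi> P q = P q \<or> pullback A \<phi> P q = (\<lambda>v. - P q v)"
      by (rule popp_volume_pullback[OF D assms(3)])
  qed
qed

end
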